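(* Let $\tau\in\mathbb{H}=\{\tau\in\mathbb{C}\mid\Im(\tau)>0\}$, and let $\mathcal{L}_\tau$ be the foliation on $\mathbb{P}^2$ given in the chart $(x:y:1)$ by the vector field $X_\tau=\tau x\,\partial/\partial x+y\,\partial/\partial y$. Let $\mathrm{Bir}(\mathbb{P}^2,\mathcal{L}_\tau)$ be the group of birational transformations of $\mathbb{P}^2$ that preserve $\mathcal{L}_\tau$. Let $G_0^\tau\subset\mathrm{PGL}(3,\mathbb{C})\cap\mathrm{Bir}(\mathbb{P}^2,\mathcal{L}_\tau)$ be the subgroup generated by the flows of $X_\tau$ and $x\,\partial/\partial x$. Let $I_\tau\subset\mathrm{SL}(2,\mathbb{Z})$ be the stabilizer of $\tau$ under the action of $\mathrm{SL}(2,\mathbb{Z})$ on $\mathbb{H}$ by fractional linear transformations. Then $\mathrm{Bir}(\mathbb{P}^2,\mathcal{L}_\tau)$ is the semidirect product $I_\tau\ltimes G_0^\tau$ (with $G_0^\tau$ the normal factor), with $I_\tau$ acting birationally on $\mathbb{P}^2$ via the monomial action.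
   Context: For $A=\begin{pmatrix}a&b\\c&d\end{pmatrix}\in\mathrm{SL}(2,\mathbb{Z})$, the action on $\mathbb{H}$ is $A\cdot\tau=\frac{a\tau+b}{c\tau+d}$, and the monomial action on $\mathbb{P}^2$ is by the birational transformations $A\cdot(x:y:1)=(x^ay^b:x^cy^d:1)$. One has $A_*\mathcal{L}_\tau=\mathcal{L}_{A\cdot\tau}$, so $I_\tau$ acts on $\mathbb{P}^2$ by elements of $\mathrm{Bir}(\mathbb{P}^2,\mathcal{L}_\tau)$. *)

theory Defs
  imports "HOL-Analysis.Analysis" "HOL-Algebra.Group_Action" "HOL-Algebra.Generated_Groups"
begin

section \<open>Rational self-maps of the complex projective plane\<close>

definition form :: "nat \<Rightarrow> (complex^3 \<Rightarrow> complex) \<Rightarrow> bool"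
  where "form d p \<longleftrightarrow> (\<exists>c :: nat \<Rightarrow> nat \<Rightarrow> complex. \<forall>v. p v =
           (\<Sum>i\<le>d. \<Sum>j\<le>d - i. c i j * (v $ 1) ^ i * (v $ 2) ^ j * (v $ 3) ^ (d - i - j)))"

text \<open>
  Homogeneous polynomial maps, not identically zero. Forms are identified with the functions
  they induce on complex 3-space. The three components may have common factors.
\<close>

definition hom_maps :: "(complex^3 \<Rightarrow> complex^3) set"
  where "hom_maps = {f. (\<exists>d. \<forall>k. form d (\<lambda>v. f v $ k)) \<and> (\<exists>v. f v \<noteq> 0)}"

definition proportional :: "complex^3 \<Rightarrow> complex^3 \<Rightarrow> bool"
  where "proportional u v \<longleftrightarrow> (\<forall>i j. u $ i * v $ j = u $ j * v $ i)"

text \<open>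
  A rational self-map of the plane is a class of this relation: it consists of all the triples
  \<open>(f\<^sub>1 : f\<^sub>2 : f\<^sub>3)\<close> of forms of equal degree that express it.
\<close>

definition same_rational_map :: "((complex^3 \<Rightarrow> complex^3) \<times> (complex^3 \<Rightarrow> complex^3)) set"
  where "same_rational_map =
           {(f, g). f \<in> hom_maps \<and> g \<in> hom_maps \<and> (\<forall>v. proportional (f v) (g v))}"

type_synonym rational_map = "(complex^3 \<Rightarrow> complex^3) set"

definition rational_map_of :: "(complex^3 \<Rightarrow> complex^3) \<Rightarrow> rational_map"
  where "rational_map_of f = same_rational_map `` {f}"

definition birational :: "(complex^3 \<Rightarrow> complex^3) \<Rightarrow> bool"
  where "birational f \<longleftrightarrow> f \<in> hom_maps \<and>
           (\<exists>g\<in>hom_maps. (f \<circ> g, id) \<in> same_rational_map \<and> (g \<circ> f, id) \<in> same_rational_map)"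

definition Bir_P2 :: "rational_map monoid"
  where "Bir_P2 =
           \<lparr>carrier = {rational_map_of f | f. birational f},
            mult = (\<lambda>\<phi> \<psi>. \<Union>f\<in>\<phi>. \<Union>g\<in>\<psi>. rational_map_of (f \<circ> g)),
            one = rational_map_of id\<rparr>"

definition PGL3 :: "rational_map set"
  where "PGL3 = {rational_map_of (\<lambda>v. M *v v) | M :: complex^3^3. det M \<noteq> 0}"


section \<open>The affine chart\<close>

type_synonym chart = "complex \<times> complex"

definition from_chart :: "chart \<Rightarrow> complex^3"
  where "from_chart p = vector [fst p, snd p, 1]"

text \<open>
  The rational map that is given by \<open>T\<close> on the (Zariski dense) subset \<open>U\<close> of the chart; if \<open>T\<close>
  is not rational then this is empty, hence not a rational map.
\<close>

definition rational_map_in_chart :: "chart set \<Rightarrow> (chart \<Rightarrow> chart) \<Rightarrow> rational_map"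
  where "rational_map_in_chart U T =
           {f \<in> hom_maps. \<forall>p\<in>U. proportional (f (from_chart p)) (from_chart (T p))}"

definition chart_dom :: "(complex^3 \<Rightarrow> complex^3) \<Rightarrow> chart set"
  where "chart_dom f = {p. f (from_chart p) $ 3 \<noteq> 0}"

definition chart_map :: "(complex^3 \<Rightarrow> complex^3) \<Rightarrow> chart \<Rightarrow> chart"
  where "chart_map f p =
           (let w = f (from_chart p) in (w $ 1 / w $ 3, w $ 2 / w $ 3))"


section \<open>Vector fields, flows and foliations\<close>

type_synonym vector_field = "chart \<Rightarrow> chart"

text \<open>Complete holomorphic flows: the time \<open>t\<close> is complex.\<close>

definition is_flow :: "vector_field \<Rightarrow> (complex \<Rightarrow> chart \<Rightarrow> chart) \<Rightarrow> bool"
  where "is_flow X \<Phi> \<longleftrightarrow>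
           (\<forall>p. \<Phi> 0 p = p \<and>
             (\<forall>t. ((\<lambda>s. fst (\<Phi> s p)) has_field_derivative fst (X (\<Phi> t p))) (at t) \<and>
                  ((\<lambda>s. snd (\<Phi> s p)) has_field_derivative snd (X (\<Phi> t p))) (at t)))"

definition flow_maps :: "vector_field \<Rightarrow> rational_map set"
  where "flow_maps X = {rational_map_in_chart UNIV (\<Phi> t) | \<Phi> t. is_flow X \<Phi>}"

text \<open>
  A foliation of the plane is determined by its restriction to the chart. It is represented
  there by its field of tangent lines; at the singular points the line degenerates to zero.
\<close>

type_synonym foliation = "chart \<Rightarrow> chart set"

definition foliation_of :: "vector_field \<Rightarrow> foliation"
  where "foliation_of X p = {(c * fst (X p), c * snd (X p)) | c. True}"

definition regular_points :: "foliation \<Rightarrow> chart set"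
  where "regular_points F = {p. F p \<noteq> {0}}"

text \<open>
  \<open>\<phi>\<close> preserves \<open>F\<close> if its differential sends tangent lines to tangent lines, off the singular
  points and wherever \<open>\<phi>\<close> is a local biholomorphism between points of the chart. For birational
  \<open>\<phi>\<close> such points form a dense open set.
\<close>

definition preserves_foliation :: "rational_map \<Rightarrow> foliation \<Rightarrow> bool"
  where "preserves_foliation \<phi> F \<longleftrightarrow>
           (\<forall>f\<in>\<phi>. \<forall>p\<in>chart_dom f \<inter> regular_points F. \<forall>D.
              chart_map f p \<in> regular_points F \<longrightarrow>
              (chart_map f has_derivative D) (at p) \<longrightarrow> bij D \<longrightarrow>
              D ` F p = F (chart_map f p))"

definition Bir_foliation :: "foliation \<Rightarrow> rational_map monoid"
  where "Bir_foliation F =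
           Bir_P2\<lparr>carrier := {\<phi> \<in> carrier Bir_P2. preserves_foliation \<phi> F}\<rparr>"

definition X_field :: "complex \<Rightarrow> vector_field"
  where "X_field \<tau> = (\<lambda>(x, y). (\<tau> * x, y))"

definition x_dx :: vector_field
  where "x_dx = (\<lambda>(x, y). (x, 0))"

definition L_foliation :: "complex \<Rightarrow> foliation"
  where "L_foliation \<tau> = foliation_of (X_field \<tau>)"

definition G0 :: "complex \<Rightarrow> rational_map set"
  where "G0 \<tau> = generate (Bir_foliation (L_foliation \<tau>))
                  (flow_maps (X_field \<tau>) \<union> flow_maps x_dx)"


section \<open>The modular group\<close>

definition SL2Z :: "(int^2^2) monoid"
  where "SL2Z = \<lparr>carrier = {A. det A = 1}, mult = (**), one = mat 1\<rparr>"

definition moebius_SL2Z :: "int^2^2 \<Rightarrow> complex \<Rightarrow> complex"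
  where "moebius_SL2Z A \<tau> =
           (of_int (A $ 1 $ 1) * \<tau> + of_int (A $ 1 $ 2)) /
           (of_int (A $ 2 $ 1) * \<tau> + of_int (A $ 2 $ 2))"

definition I_stab :: "complex \<Rightarrow> (int^2^2) set"
  where "I_stab \<tau> = stabilizer SL2Z moebius_SL2Z \<tau>"

definition monomial_map :: "int^2^2 \<Rightarrow> rational_map"
  where "monomial_map A =
           rational_map_in_chart {(x, y). x \<noteq> 0 \<and> y \<noteq> 0}
             (\<lambda>(x, y). (x powi (A $ 1 $ 1) * y powi (A $ 1 $ 2),
                        x powi (A $ 2 $ 1) * y powi (A $ 2 $ 2)))"


section \<open>Semidirect products\<close>

definition internal_semidirect_product :: "('a, 'b) monoid_scheme \<Rightarrow> 'a set \<Rightarrow> 'a set \<Rightarrow> bool"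
  where "internal_semidirect_product G H N \<longleftrightarrow>
           N \<lhd> G \<and> subgroup H G \<and> H \<inter> N = {\<one>\<^bsub>G\<^esub>} \<and> H <#>\<^bsub>G\<^esub> N = carrier G"

end

theory Submission
  imports Defs "HOL-Computational_Algebra.Polynomial_Factorial" "HOL-Computational_Algebra.Field_as_Ring"
begin

text \<open>
  In the chart, a birational map that preserves \<open>\<L>\<^sub>\<tau>\<close> is a triple of polynomials whose logarithmic
  derivatives along \<open>X\<^sub>\<tau>\<close> satisfy a linear relation with coefficients \<open>1, - \<tau>, \<tau> - 1\<close>. Compare the
  residues along a prime \<open>p\<close>: since \<open>\<tau>\<close> is not real, \<open>p\<close> has the same multiplicity in the three
  polynomials unless it is \<open>X\<^sub>\<tau>\<close>-invariant, that is, an eigenvector of \<open>X\<^sub>\<tau>\<close>. The eigenvalues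
  \<open>i \<tau> + j\<close> of the monomials are pairwise distinct, so the only such primes are the coordinates. Hence the
  map is a monomial map composed with a diagonal one. The relation then says that its exponent matrix
  fixes \<open>\<tau>\<close>, which makes the determinant positive, and injectivity on the torus makes it equal to 1.
\<close>

section \<open>Bivariate polynomials and the Euler derivation\<close>

text \<open>With D the derivation along X_\<tau>, tangency of the image vector at (P/R, Q/R) means
  that the logarithmic derivative of P/R is \<tau> times that of Q/R; this is the linear relation. A
  prime of multiplicities k, l, m in P, Q, R then gives k - m = \<tau> (l - m). Two obstacles shape
  the argument. A rational map is the class of all its triples, common factors included, so P, Q, R
  cannot be taken coprime and every criterion has to tolerate a factor H shared by all three. And
  preservation is tested only at regular chart points with a bijective differential, so the relation
  is first obtained off the zeros of a suitable form and then spread as a polynomial identity.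
  Positivity of the determinant comes from det A = |c \<tau> + d|^2, valid when (\<tau>, 1) is an
  eigenvector of A and (c, d) is the lower row; a determinant above 1 would put nontrivial torsion
  points of the torus into the kernel. Once maps are pairs of a matrix and a torus point, the group
  statements are computations with such pairs.\<close>

definition eval2 :: "complex poly poly \<Rightarrow> complex \<Rightarrow> complex \<Rightarrow> complex"
  where "eval2 P x y = poly (poly P [:y:]) x"

lemma eval2_simps [simp]:
  "eval2 0 x y = 0" "eval2 1 x y = 1"
  "eval2 (P + Q) x y = eval2 P x y + eval2 Q x y"
  "eval2 (P - Q) x y = eval2 P x y - eval2 Q x y"
  "eval2 (P * Q) x y = eval2 P x y * eval2 Q x y"
  "eval2 (P ^ n) x y = eval2 P x y ^ n"
  "eval2 (smult p Q) x y = poly p x * eval2 Q x y"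
  "eval2 (pCons p P) x y = poly p x + y * eval2 P x y"
  "eval2 (monom p n) x y = poly p x * y ^ n"
  by (simp_all add: eval2_def poly_monom)

lemma eval2_sum [simp]: "eval2 (\<Sum>i\<in>I. P i) x y = (\<Sum>i\<in>I. eval2 (P i) x y)"
  by (simp add: eval2_def poly_sum)

text \<open>For each complex y the polynomial \<open>P - Q\<close> in the outer variable has the
  constant \<open>[:y:]\<close> as a root. Infinitely many roots over the integral domain of
  polynomials in x leave only the zero polynomial.\<close>

lemma eval2_eqI:
  assumes "\<And>x y. eval2 P x y = eval2 Q x y"
  shows "P = Q"
proof -
  have "poly (P - Q) [:y:] = 0" for y
    using assms by (subst poly_all_0_iff_0[symmetric]) (simp add: eval2_def)
  then have "range (\<lambda>y. [:y:]) \<subseteq> {z. poly (P - Q) z = 0}"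
    by auto
  moreover have "infinite (range (\<lambda>y::complex. [:y:]))"
    using finite_imageD[of "\<lambda>y::complex. [:y:]" UNIV] infinite_UNIV_char_0
    by (auto simp: inj_on_def)
  ultimately have "P - Q = 0"
    by (metis poly_roots_finite finite_subset)
  then show ?thesis by simp
qed

text \<open>The vector field X_\<tau> as a derivation. With x as inner and y as outer variable,
  \<open>map_poly pderiv\<close> is the partial derivative in x, \<open>pderiv\<close> the one in y,
  and \<open>pCons 0\<close> multiplies by y.\<close>

definition euler_deriv :: "complex \<Rightarrow> complex poly poly \<Rightarrow> complex poly poly"
  where "euler_deriv \<tau> P = smult [:0, \<tau>:] (map_poly pderiv P) + pCons 0 (pderiv P)"

lemma coeff_euler_deriv:
  "coeff (coeff (euler_deriv \<tau> P) j) i = (\<tau> * of_nat i + of_nat j) * coeff (coeff P j) i"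
proof -
  have 1: "coeff (pCons 0 (pderiv P)) j = of_nat j * coeff P j"
    by (cases j) (simp_all add: coeff_pderiv)
  have 2: "coeff (smult [:0, \<tau>:] (map_poly pderiv P)) j = pCons 0 (smult \<tau> (pderiv (coeff P j)))"
    by (simp add: coeff_map_poly)
  have 3: "coeff (pCons 0 (smult \<tau> (pderiv p))) i = \<tau> * of_nat i * coeff p i" for p
    by (cases i) (simp_all add: coeff_pderiv)
  have 4: "coeff (of_nat j * p) i = of_nat j * coeff p i" for p :: "complex poly"
    by (simp add: of_nat_poly)
  show ?thesis
    unfolding euler_deriv_def coeff_add 1 2 3 4 by (simp add: algebra_simps)
qed

lemma map_poly_pderiv_mult:
  fixes P Q :: "complex poly poly"
  shows "map_poly pderiv (P * Q) = map_poly pderiv P * Q + P * map_poly pderiv Q"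
proof (induction P)
  case 0
  then show ?case by simp
next
  case (pCons a P)
  have add: "map_poly pderiv (A + B) = map_poly pderiv A + map_poly pderiv B" for A B :: "complex poly poly"
    by (intro poly_eqI) (simp add: coeff_map_poly pderiv_add)
  have smult: "map_poly pderiv (smult a A) = smult (pderiv a) A + smult a (map_poly pderiv A)" for A
    by (intro poly_eqI) (simp add: coeff_map_poly pderiv_mult algebra_simps)
  show ?case
    by (simp add: add smult map_poly_pCons pCons.IH algebra_simps)
qed

lemma euler_deriv_mult: "euler_deriv \<tau> (P * Q) = euler_deriv \<tau> P * Q + P * euler_deriv \<tau> Q"
proof -
  have "pCons 0 A = [:0,1:] * A" for A :: "complex poly poly" by simp
  then show ?thesis unfolding euler_deriv_def map_poly_pderiv_mult pderiv_mult
    by (simp add: algebra_simps smult_add_right)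
qed

text \<open>The extra factor \<open>P\<close> keeps the exponent \<open>n - 1\<close>, truncated at
  \<open>n = 0\<close>, out of the formula.\<close>

lemma euler_deriv_power: "P * euler_deriv \<tau> (P ^ n) = of_nat n * P ^ n * euler_deriv \<tau> P"
proof (induction n)
  case 0
  have "euler_deriv \<tau> 1 = 0"
    using euler_deriv_mult[of \<tau> 1 1] by simp
  then show ?case by simp
next
  case (Suc n)
  then show ?case by (simp add: euler_deriv_mult algebra_simps)
qed

lemma euler_deriv_monom:
  "euler_deriv \<tau> (monom (monom c a) b) = smult [:\<tau> * of_nat a + of_nat b:] (monom (monom c a) b)"
  by (intro poly_eqI) (simp add: coeff_euler_deriv)

text \<open>The derivation raises neither the degree in y nor the degree in x of the leading
  coefficient, so the cofactor of \<open>p\<close> is a constant and \<open>p\<close> is an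
  eigenvector. Its monomials then share one eigenvalue, whose imaginary part determines the exponent
  of x.\<close>

lemma euler_invariant_imp_monom:
  assumes "Im \<tau> \<noteq> 0" "p \<noteq> 0" "p dvd euler_deriv \<tau> p"
  shows "\<exists>c i j. p = monom (monom c i) j"
proof -
  obtain q where q: "euler_deriv \<tau> p = p * q" using assms(3) by auto
  have "degree q = 0"
  proof (cases "q = 0")
    case False
    then have "degree (euler_deriv \<tau> p) = degree p + degree q"
      unfolding q using assms(2) by (simp add: degree_mult_eq)
    moreover have "degree (euler_deriv \<tau> p) \<le> degree p"
      by (intro degree_le allI impI poly_eqI) (simp add: coeff_euler_deriv coeff_eq_0)
    ultimately show ?thesis by simp
  qed simp
  then obtain q0 where q0: "q = [:q0:]" by (meson degree_eq_zeroE)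
  define r where "r = lead_coeff p"
  have "r \<noteq> 0" using assms(2) by (simp add: r_def)
  have r: "coeff (euler_deriv \<tau> p) (degree p) = r * q0"
    by (simp add: q q0 r_def)
  have "degree q0 = 0"
  proof (cases "q0 = 0")
    case False
    then have "degree (coeff (euler_deriv \<tau> p) (degree p)) = degree r + degree q0"
      unfolding r using \<open>r \<noteq> 0\<close> by (simp add: degree_mult_eq)
    moreover have "degree (coeff (euler_deriv \<tau> p) (degree p)) \<le> degree r"
      by (intro degree_le allI impI) (simp add: coeff_euler_deriv coeff_eq_0 r_def)
    ultimately show ?thesis by simp
  qed simp
  then obtain l where l: "q0 = [:l:]" by (meson degree_eq_zeroE)
  have eig: "\<tau> * of_nat i + of_nat j = l" if "coeff (coeff p j) i \<noteq> 0" for i j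
    using coeff_euler_deriv[of \<tau> p j i] that by (simp add: q q0 l)
  obtain i where i: "coeff (coeff p (degree p)) i \<noteq> 0"
    using \<open>r \<noteq> 0\<close> unfolding r_def by (metis leading_coeff_0_iff)
  define j where "j = degree p"
  have "i' = i \<and> j' = j" if "coeff (coeff p j') i' \<noteq> 0" for i' j'
  proof -
    have *: "\<tau> * of_nat i + of_nat j = \<tau> * of_nat i' + of_nat j'"
      using eig[OF that] eig[OF i] by (simp add: j_def)
    have "Im (\<tau> * of_nat i + of_nat j) = Im (\<tau> * of_nat i' + of_nat j')"
      by (simp only: *)
    then have "Im \<tau> * of_nat i = Im \<tau> * of_nat i'" by simp
    then have "i = i'" using assms(1) by simp
    then show ?thesis using * by simp
  qed
  then have "p = monom (monom (coeff (coeff p j) i) i) j"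
    by (intro poly_eqI) (auto)
  then show ?thesis by blast
qed

text \<open>These are y and x, in this order. Primality of x is lifted from the coefficient
  ring.\<close>

lemma prime_elem_bivariate_vars:
  "prime_elem ([:0, 1:] :: complex poly poly)" "prime_elem ([:[:0, 1:]:] :: complex poly poly)"
  by (rule prime_elem_linear_poly; simp) (intro lift_prime_elem_poly prime_elem_linear_field_poly; simp)

lemma monom_bivariate:
  "monom (monom (c::complex) i) j = [:[:c:]:] * ([:[:0, 1:]:] ^ i * [:0, 1:] ^ j)"
  by (rule eval2_eqI) (simp add: poly_monom)

text \<open>An invariant prime is a monomial and divides itself, hence divides its constant, x or y;
  the constant is excluded as a unit.\<close>

lemma prime_dvd_euler_deriv:
  assumes "Im \<tau> \<noteq> 0" "prime_elem p" "p dvd euler_deriv \<tau> p"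
  shows "p dvd [:0, 1:] \<or> p dvd [:[:0, 1:]:]"
proof -
  have "p \<noteq> 0" using assms(2) by auto
  then obtain c i j where p: "p = monom (monom c i) j"
    using euler_invariant_imp_monom[OF assms(1) _ assms(3)] by blast
  then have "c \<noteq> 0" using \<open>p \<noteq> 0\<close> by auto
  then have "is_unit [:[:c:]:]" by (simp add: is_unit_const_poly_iff dvd_field_iff)
  have "p dvd [:[:c:]:] * ([:[:0, 1:]:] ^ i * [:0, 1:] ^ j)"
    using p monom_bivariate by simp
  moreover have "\<not> p dvd [:[:c:]:]"
    using assms(2) \<open>is_unit [:[:c:]:]\<close> by (meson dvd_trans prime_elem_not_unit)
  ultimately show ?thesis
    using assms(2) by (metis prime_elem_dvd_mult_iff prime_elem_dvd_power)
qed

text \<open>This is PQR times DP/P - \<tau> DQ/Q - (1 - \<tau>) DR/R, where D is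
  \<open>euler_deriv \<tau>\<close>. Its vanishing says that the map (P/R, Q/R), where defined,
  sends X_\<tau> to vectors tangent to the foliation.\<close>

definition foliation_defect :: "complex \<Rightarrow> complex poly poly \<Rightarrow> complex poly poly \<Rightarrow> complex poly poly \<Rightarrow> complex poly poly"
  where "foliation_defect \<tau> P Q R = euler_deriv \<tau> P * Q * R - [:[:\<tau>:]:] * (P * euler_deriv \<tau> Q * R)
           - [:[:1 - \<tau>:]:] * (P * Q * euler_deriv \<tau> R)"

text \<open>
  At a prime \<open>p\<close> the logarithmic derivative of \<open>p\<^sup>n u\<close> has a pole with residue \<open>n\<close> unless
  \<open>p\<close> is invariant, so the residues in the vanishing defect must cancel.
\<close>

lemma multiplicity_eq_of_defect:
  assumes \<tau>: "Im \<tau> \<noteq> 0" and nz: "P \<noteq> 0" "Q \<noteq> 0" "R \<noteq> 0"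
    and defect: "foliation_defect \<tau> P Q R = 0"
    and p: "prime_elem p" "\<not> p dvd euler_deriv \<tau> p"
  shows "multiplicity p P = multiplicity p R" "multiplicity p Q = multiplicity p R"
proof -
  have "p \<noteq> 0" "\<not> is_unit p" using p by auto
  define k l m where "k = multiplicity p P" "l = multiplicity p Q" "m = multiplicity p R"
  obtain u where u: "P = p ^ k * u" "\<not> p dvd u"
    using multiplicity_decompose'[OF nz(1) \<open>\<not> is_unit p\<close>] k_l_m_def by metis
  obtain v where v: "Q = p ^ l * v" "\<not> p dvd v"
    using multiplicity_decompose'[OF nz(2) \<open>\<not> is_unit p\<close>] k_l_m_def by metis
  obtain w where w: "R = p ^ m * w" "\<not> p dvd w"
    using multiplicity_decompose'[OF nz(3) \<open>\<not> is_unit p\<close>] k_l_m_def by metis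
  let ?D = "euler_deriv \<tau>"
  have deriv: "p * ?D (p ^ n * a) = p ^ n * (of_nat n * ?D p * a + p * ?D a)" for n a
    using euler_deriv_power[of p \<tau> n] by (simp add: euler_deriv_mult algebra_simps)
  \<comment> \<open>The combination k - \<tau> l - (1 - \<tau>) m of the residues, arranged so that
    only k - m and l - m enter.\<close>
  define e where "e = (of_nat k - of_nat m) - \<tau> * (of_nat l - of_nat m :: complex)"
  define r where "r = ?D u * v * w - [:[:\<tau>:]:] * (u * ?D v * w) - [:[:1 - \<tau>:]:] * (u * v * ?D w)"
  have e: "[:[:e:]:] = of_nat k - [:[:\<tau>:]:] * of_nat l - [:[:1 - \<tau>:]:] * (of_nat m :: complex poly poly)"
    by (simp add: e_def of_nat_poly algebra_simps)
  have ring: "N * (k * Z + p * A) - t * (N * (l * Z + p * B)) - s * (N * (m * Z + p * C))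
      = N * ((k - t * l - s * m) * Z + p * (A - t * B - s * C))"
    for N k l m t s p A B C Z :: "complex poly poly"
    by (simp only: algebra_simps)
  have "p * foliation_defect \<tau> P Q R
      = (p * ?D P) * Q * R - [:[:\<tau>:]:] * (P * (p * ?D Q) * R) - [:[:1 - \<tau>:]:] * (P * Q * (p * ?D R))"
    unfolding foliation_defect_def by (simp only: algebra_simps)
  also have "p * ?D P * Q * R = p ^ (k + l + m) * (of_nat k * (?D p * (u * (v * w))) + p * (?D u * v * w))"
    unfolding u(1) v(1) w(1) deriv by (simp only: power_add algebra_simps)
  also have "P * (p * ?D Q) * R = p ^ (k + l + m) * (of_nat l * (?D p * (u * (v * w))) + p * (u * ?D v * w))"
    unfolding u(1) v(1) w(1) deriv by (simp only: power_add algebra_simps)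
  also have "P * Q * (p * ?D R) = p ^ (k + l + m) * (of_nat m * (?D p * (u * (v * w))) + p * (u * v * ?D w))"
    unfolding u(1) v(1) w(1) deriv by (simp only: power_add algebra_simps)
  finally have "p * foliation_defect \<tau> P Q R = p ^ (k + l + m) * ([:[:e:]:] * (?D p * (u * (v * w))) + p * r)"
    unfolding e r_def by (simp only: ring)
  \<comment> \<open>The vanishing defect makes e Dp u v w divisible by p. None of Dp, u, v, w is, so
    p divides the constant e; a nonzero constant would be a unit.\<close>
  then have "[:[:e:]:] * (?D p * (u * (v * w))) = p * (- r)"
    using defect \<open>p \<noteq> 0\<close> by (simp add: eq_neg_iff_add_eq_0)
  then have "p dvd [:[:e:]:] * (?D p * (u * (v * w)))" by simp
  then have "p dvd [:[:e:]:]"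
    using p u(2) v(2) w(2) by (meson prime_elem_dvd_mult_iff)
  then have "e = 0"
    using \<open>\<not> is_unit p\<close> by (metis dvd_trans is_unit_const_poly_iff dvd_field_iff one_neq_zero)
  have "Im e = Im \<tau> * (of_nat m - of_nat l)" by (simp add: e_def algebra_simps)
  then have "l = m" using \<open>e = 0\<close> \<tau> by simp
  then have "k = m" using \<open>e = 0\<close> by (simp add: e_def)
  then show "multiplicity p P = multiplicity p R" "multiplicity p Q = multiplicity p R"
    using \<open>l = m\<close> by (simp_all add: k_l_m_def)
qed

section \<open>Splitting off the coordinates and comparing prime factorizations\<close>

lemma extract_bivariate_vars:
  fixes P :: "complex poly poly"
  assumes "P \<noteq> 0"
  obtains a b u where "P = [:[:0, 1:]:] ^ a * [:0, 1:] ^ b * u"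
    "\<not> [:[:0, 1:]:] dvd u" "\<not> [:0, 1:] dvd u"
proof -
  let ?x = "[:[:0, 1:]:] :: complex poly poly" and ?y = "[:0, 1:] :: complex poly poly"
  obtain a r where r: "P = ?x ^ a * r" "\<not> ?x dvd r"
    using multiplicity_decompose'[OF assms] prime_elem_bivariate_vars(2) prime_elem_not_unit by metis
  then have "r \<noteq> 0" by auto
  then obtain b u where u: "r = ?y ^ b * u" "\<not> ?y dvd u"
    using multiplicity_decompose'[of r ?y] prime_elem_bivariate_vars(1) prime_elem_not_unit by metis
  have "\<not> ?x dvd u" using r(2) u(1) by (metis dvd_mult)
  show ?thesis
    by (rule that[OF _ \<open>\<not> ?x dvd u\<close> u(2)]) (simp only: r(1) u(1) mult.assoc)
qed

lemma multiplicity_extract: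
  assumes "prime p" "\<not> p dvd x" "\<not> p dvd y" "u \<noteq> 0" "x \<noteq> 0" "y \<noteq> 0"
  shows "multiplicity p (x ^ a * y ^ b * u) = multiplicity p u"
  using assms
  by (simp add: prime_elem_multiplicity_mult_distrib prime_elem_multiplicity_power_distrib
      not_dvd_imp_multiplicity_0)

text \<open>Once the powers of x and y are split off, every prime has the same multiplicity in the
  three cofactors: by the residue argument, or because the prime is a coordinate and divides none of
  them. Unique factorization makes the cofactors associates of one polynomial
  \<open>H\<close>.\<close>

lemma monomial_multiples_of_defect:
  assumes \<tau>: "Im \<tau> \<noteq> 0" and nz: "P \<noteq> 0" "Q \<noteq> 0" "R \<noteq> 0"
    and defect: "foliation_defect \<tau> P Q R = 0"
  obtains H \<alpha> a a' \<beta> b b' \<gamma> c c' where "H \<noteq> 0" "\<alpha> \<noteq> 0" "\<beta> \<noteq> 0" "\<gamma> \<noteq> 0"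
    "P = monom (monom \<alpha> a) a' * H" "Q = monom (monom \<beta> b) b' * H" "R = monom (monom \<gamma> c) c' * H"
proof -
  let ?x = "[:[:0, 1:]:] :: complex poly poly" and ?y = "[:0, 1:] :: complex poly poly"
  obtain a a' u where u: "P = ?x ^ a * ?y ^ a' * u" "\<not> ?x dvd u" "\<not> ?y dvd u"
    using extract_bivariate_vars[OF nz(1)] .
  obtain b b' v where v: "Q = ?x ^ b * ?y ^ b' * v" "\<not> ?x dvd v" "\<not> ?y dvd v"
    using extract_bivariate_vars[OF nz(2)] .
  obtain c c' w where w: "R = ?x ^ c * ?y ^ c' * w" "\<not> ?x dvd w" "\<not> ?y dvd w"
    using extract_bivariate_vars[OF nz(3)] .
  have uvw: "u \<noteq> 0" "v \<noteq> 0" "w \<noteq> 0" using u v w by auto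
  have mult: "multiplicity p u = multiplicity p w \<and> multiplicity p v = multiplicity p w"
    if p: "prime p" for p
  proof (cases "p dvd ?x \<or> p dvd ?y")
    case True
    \<comment> \<open>A prime that divides a coordinate is associated to it, and \<open>u\<close>,
      \<open>v\<close>, \<open>w\<close> are free of both coordinates.\<close>
    have "\<not> p dvd t" if "\<not> ?x dvd t" "\<not> ?y dvd t" for t
    proof -
      have "irreducible ?x" "irreducible ?y"
        by (simp_all add: prime_elem_imp_irreducible prime_elem_bivariate_vars)
      moreover have "\<not> is_unit p" using p by auto
      ultimately have "?x dvd p \<or> ?y dvd p"
        using True irreducibleD' by blast
      then show ?thesis using that dvd_trans by blast
    qed
    then show ?thesis using u v w by (simp add: not_dvd_imp_multiplicity_0)
  next
    case False
    then have "\<not> p dvd euler_deriv \<tau> p"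
      using prime_dvd_euler_deriv[OF \<tau>] p by blast
    then have "multiplicity p P = multiplicity p R" "multiplicity p Q = multiplicity p R"
      using multiplicity_eq_of_defect[OF \<tau> nz defect] p by blast+
    moreover have "multiplicity p P = multiplicity p u" "multiplicity p Q = multiplicity p v"
      "multiplicity p R = multiplicity p w"
      unfolding u(1) v(1) w(1) using False p uvw by (auto intro!: multiplicity_extract)
    ultimately show ?thesis by simp
  qed
  have norm: "normalize u = normalize w" "normalize v = normalize w"
    using mult uvw by (auto simp flip: prime_factorization_unique intro!: multiset_eqI simp: count_prime_factorization)
  have scale: "\<exists>e. e \<noteq> 0 \<and> t = [:[:e:]:] * normalize t" if "t \<noteq> 0" for t :: "complex poly poly"
  proof -
    have "is_unit (unit_factor t)" using that by simp
    then obtain e where "unit_factor t = [:[:e:]:]" "e \<noteq> 0"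
      by (auto simp: is_unit_poly_iff dvd_field_iff)
    then show ?thesis by (metis unit_factor_mult_normalize)
  qed
  define H where "H = normalize w"
  obtain \<alpha> where \<alpha>: "\<alpha> \<noteq> 0" "u = [:[:\<alpha>:]:] * H" using scale[OF uvw(1)] norm H_def by auto
  obtain \<beta> where \<beta>: "\<beta> \<noteq> 0" "v = [:[:\<beta>:]:] * H" using scale[OF uvw(2)] norm H_def by auto
  obtain \<gamma> where \<gamma>: "\<gamma> \<noteq> 0" "w = [:[:\<gamma>:]:] * H" using scale[OF uvw(3)] norm H_def by auto
  show ?thesis
  proof (rule that)
    show "H \<noteq> 0" using uvw by (simp add: H_def)
    show "P = monom (monom \<alpha> a) a' * H" "Q = monom (monom \<beta> b) b' * H" "R = monom (monom \<gamma> c) c' * H"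
      unfolding monom_bivariate u(1) v(1) w(1) \<alpha>(2) \<beta>(2) \<gamma>(2) by (simp_all only: mult_ac)
  qed (use \<alpha> \<beta> \<gamma> in auto)
qed

text \<open>The common factor enters with total coefficient 1 - \<tau> - (1 - \<tau>) = 0 and drops
  out; what remains is the same combination of the eigenvalues of the three monomials.\<close>

lemma defect_monomial_multiples:
  assumes "H \<noteq> 0" "\<alpha> \<noteq> 0" "\<beta> \<noteq> 0" "\<gamma> \<noteq> 0"
    "foliation_defect \<tau> (monom (monom \<alpha> a) a' * H) (monom (monom \<beta> b) b' * H) (monom (monom \<gamma> c) c' * H) = 0"
  shows "(of_nat a - of_nat c) * \<tau> + (of_nat a' - of_nat c')
       = \<tau> * ((of_nat b - of_nat c) * \<tau> + (of_nat b' - of_nat c'))"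
proof -
  define A B C where "A = monom (monom \<alpha> a) a'" "B = monom (monom \<beta> b) b'" "C = monom (monom \<gamma> c) c'"
  have D: "euler_deriv \<tau> A = [:[:\<tau> * of_nat a + of_nat a':]:] * A"
    "euler_deriv \<tau> B = [:[:\<tau> * of_nat b + of_nat b':]:] * B"
    "euler_deriv \<tau> C = [:[:\<tau> * of_nat c + of_nat c':]:] * C"
    unfolding A_B_C_def euler_deriv_monom by simp_all
  define e where "e = (\<tau> * of_nat a + of_nat a') - \<tau> * (\<tau> * of_nat b + of_nat b') - (1 - \<tau>) * (\<tau> * of_nat c + of_nat c')"
  have "foliation_defect \<tau> (A * H) (B * H) (C * H) = [:[:e:]:] * (A * B * C * H ^ 3)"
    unfolding foliation_defect_def euler_deriv_mult D
    by (rule eval2_eqI) (simp add: e_def algebra_simps power3_eq_cube)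
  then have "[:[:e:]:] * (A * B * C * H ^ 3) = 0" using assms(5) A_B_C_def by simp
  then have "e = 0" using assms by (simp add: A_B_C_def)
  then show ?thesis by (simp add: e_def algebra_simps)
qed

section \<open>Homogeneous maps and rational maps\<close>

lemma form_add:
  assumes "form d p" "form d q"
  shows "form d (\<lambda>v. p v + q v)"
proof -
  obtain c c' where
    "\<And>v. p v = (\<Sum>i\<le>d. \<Sum>j\<le>d - i. c i j * (v $ 1) ^ i * (v $ 2) ^ j * (v $ 3) ^ (d - i - j))"
    "\<And>v. q v = (\<Sum>i\<le>d. \<Sum>j\<le>d - i. c' i j * (v $ 1) ^ i * (v $ 2) ^ j * (v $ 3) ^ (d - i - j))"
    using assms unfolding form_def by blast
  then show ?thesis
    unfolding form_def
    by (intro exI[of _ "\<lambda>i j. c i j + c' i j"]) (simp add: sum.distrib algebra_simps)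
qed

lemma form_cmult:
  assumes "form d p"
  shows "form d (\<lambda>v. a * p v)"
proof -
  obtain c where
    "\<And>v. p v = (\<Sum>i\<le>d. \<Sum>j\<le>d - i. c i j * (v $ 1) ^ i * (v $ 2) ^ j * (v $ 3) ^ (d - i - j))"
    using assms unfolding form_def by blast
  then show ?thesis
    unfolding form_def
    by (intro exI[of _ "\<lambda>i j. a * c i j"]) (simp add: sum_distrib_left algebra_simps)
qed

lemma form_zero: "form d (\<lambda>v. 0)"
  unfolding form_def by (intro exI[of _ "\<lambda>i j. 0"]) simp

lemma form_diff:
  assumes "form d p" "form d q"
  shows "form d (\<lambda>v. p v - q v)"
  using form_add[OF assms(1) form_cmult[OF assms(2), of "-1"]] by simp

lemma form_sum:
  assumes "\<And>i. i \<in> I \<Longrightarrow> form d (p i)"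
  shows "form d (\<lambda>v. \<Sum>i\<in>I. p i v)"
  using assms by (induction I rule: infinite_finite_induct) (auto intro: form_zero form_add)

lemma form_monomial:
  assumes "i + j + k = d"
  shows "form d (\<lambda>v. (v $ 1) ^ i * (v $ 2) ^ j * (v $ 3) ^ k)"
proof -
  have "(v $ 1) ^ i * (v $ 2) ^ j * (v $ 3) ^ k =
      (\<Sum>i'\<le>d. \<Sum>j'\<le>d - i'. (if i' = i then if j' = j then 1 else 0 else 0)
         * (v $ 1) ^ i' * (v $ 2) ^ j' * (v $ 3) ^ (d - i' - j'))" for v :: "complex^3"
  proof -
    have "(\<Sum>j'\<le>d - i'. (if i' = i then if j' = j then 1 else 0 else 0)
         * (v $ 1) ^ i' * (v $ 2) ^ j' * (v $ 3) ^ (d - i' - j'))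
       = (if i' = i then (v $ 1) ^ i * (v $ 2) ^ j * (v $ 3) ^ k else 0)" for i'
    proof (cases "i' = i")
      case True
      have "(\<Sum>j'\<le>d - i. (if j' = j then 1 else 0) * (v $ 1) ^ i * (v $ 2) ^ j' * (v $ 3) ^ (d - i - j'))
          = (\<Sum>j'\<le>d - i. if j' = j then (v $ 1) ^ i * (v $ 2) ^ j * (v $ 3) ^ (d - i - j) else 0)"
        by (intro sum.cong) auto
      also have "\<dots> = (v $ 1) ^ i * (v $ 2) ^ j * (v $ 3) ^ k"
        using assms by (auto simp: sum.delta)
      finally show ?thesis using True by simp
    qed simp
    then show ?thesis using assms by (simp add: sum.delta)
  qed
  then show ?thesis
    unfolding form_def
    by (intro exI[of _ "\<lambda>i' j'. if i' = i then if j' = j then 1 else 0 else 0"]) blast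
qed

lemma form_mult:
  assumes "form d p" "form e q"
  shows "form (d + e) (\<lambda>v. p v * q v)"
proof -
  obtain c c' where
    p: "\<And>v. p v = (\<Sum>i\<le>d. \<Sum>j\<le>d - i. c i j * (v $ 1) ^ i * (v $ 2) ^ j * (v $ 3) ^ (d - i - j))" and
    q: "\<And>v. q v = (\<Sum>i\<le>e. \<Sum>j\<le>e - i. c' i j * (v $ 1) ^ i * (v $ 2) ^ j * (v $ 3) ^ (e - i - j))"
    using assms unfolding form_def by blast
  have "form (d + e) (\<lambda>v. (c i j * (v $ 1) ^ i * (v $ 2) ^ j * (v $ 3) ^ (d - i - j))
      * (c' i' j' * (v $ 1) ^ i' * (v $ 2) ^ j' * (v $ 3) ^ (e - i' - j')))"
    if "i \<le> d" "j \<le> d - i" "i' \<le> e" "j' \<le> e - i'" for i j i' j'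
  proof -
    have "form (d + e) (\<lambda>v. (c i j * c' i' j') *
       ((v $ 1) ^ (i + i') * (v $ 2) ^ (j + j') * (v $ 3) ^ ((d - i - j) + (e - i' - j'))))"
      using that by (intro form_cmult form_monomial) simp
    then show ?thesis
      by (rule back_subst[of "form (d + e)"]) (simp add: power_add fun_eq_iff)
  qed
  then show ?thesis
    unfolding p q sum_distrib_left sum_distrib_right by (intro form_sum) simp
qed

lemma form_power: "form d p \<Longrightarrow> form (d * n) (\<lambda>v. p v ^ n)"
proof (induction n)
  case 0
  show ?case using form_monomial[of 0 0 0 0] by simp
next
  case (Suc n)
  then show ?case using form_mult[of d p "d * n" "\<lambda>v. p v ^ n"] by simp
qed

lemma form_coordinate: "form 1 (\<lambda>v. v $ k)"
  using exhaust_3[of k] form_monomial[of 1 0 0 1] form_monomial[of 0 1 0 1] form_monomial[of 0 0 1 1]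
  by auto

lemma form_compose:
  assumes "form d p" "\<And>k. form e (\<lambda>v. g v $ k)"
  shows "form (d * e) (\<lambda>v. p (g v))"
proof -
  obtain c where
    p: "\<And>v. p v = (\<Sum>i\<le>d. \<Sum>j\<le>d - i. c i j * (v $ 1) ^ i * (v $ 2) ^ j * (v $ 3) ^ (d - i - j))"
    using assms unfolding form_def by blast
  have "form (d * e) (\<lambda>v. c i j * (g v $ 1) ^ i * (g v $ 2) ^ j * (g v $ 3) ^ (d - i - j))"
    if "i \<le> d" "j \<le> d - i" for i j
  proof -
    have "form (e * i + e * j + e * (d - i - j))
       (\<lambda>v. (g v $ 1) ^ i * (g v $ 2) ^ j * (g v $ 3) ^ (d - i - j))"
      by (intro form_mult form_power assms(2))
    moreover have "e * i + e * j + e * (d - i - j) = d * e"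
      using that by (simp flip: distrib_left)
    ultimately show ?thesis
      using form_cmult by (metis (no_types, lifting) ext mult.assoc)
  qed
  then show ?thesis
    unfolding p by (intro form_sum) simp
qed

lemma form_homogeneous:
  assumes "form d p"
  shows "p (a *s v) = a ^ d * p v"
proof -
  obtain c where
    p: "\<And>v. p v = (\<Sum>i\<le>d. \<Sum>j\<le>d - i. c i j * (v $ 1) ^ i * (v $ 2) ^ j * (v $ 3) ^ (d - i - j))"
    using assms unfolding form_def by blast
  have scale: "c i j * (a * v $ 1) ^ i * (a * v $ 2) ^ j * (a * v $ 3) ^ (d - i - j)
      = a ^ d * (c i j * (v $ 1) ^ i * (v $ 2) ^ j * (v $ 3) ^ (d - i - j))"
    if "i \<le> d" "j \<le> d - i" for i j
  proof -
    have "a ^ i * a ^ j * a ^ (d - i - j) = a ^ d"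
      using that by (simp flip: power_add)
    then show ?thesis by (simp add: power_mult_distrib) (metis mult.assoc mult.commute)
  qed
  then show ?thesis
    unfolding p sum_distrib_left vector_smult_component by (intro sum.cong refl) (rule scale; simp)
qed

lemma form_on_line:
  assumes "form d p"
  shows "\<exists>P. \<forall>t. p (u + t *s w) = poly P t"
proof -
  obtain c where
    p: "\<And>v. p v = (\<Sum>i\<le>d. \<Sum>j\<le>d - i. c i j * (v $ 1) ^ i * (v $ 2) ^ j * (v $ 3) ^ (d - i - j))"
    using assms unfolding form_def by blast
  show ?thesis
    unfolding p
    by (intro exI[of _ "\<Sum>i\<le>d. \<Sum>j\<le>d - i. smult (c i j)
          ([:u $ 1, w $ 1:] ^ i * [:u $ 2, w $ 2:] ^ j * [:u $ 3, w $ 3:] ^ (d - i - j))"])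
       (simp add: poly_sum algebra_simps)
qed

section \<open>Dehomogenization and generic points\<close>

lemma from_chart_nth [simp]:
  "from_chart p $ 1 = fst p" "from_chart p $ 2 = snd p" "from_chart p $ 3 = 1"
  by (simp_all add: from_chart_def)

lemma form_in_chart:
  assumes "form d p"
  shows "\<exists>P. \<forall>x y. p (from_chart (x, y)) = eval2 P x y"
proof -
  obtain c where
    p: "\<And>v. p v = (\<Sum>i\<le>d. \<Sum>j\<le>d - i. c i j * (v $ 1) ^ i * (v $ 2) ^ j * (v $ 3) ^ (d - i - j))"
    using assms unfolding form_def by blast
  show ?thesis
    unfolding p
    by (intro exI[of _ "\<Sum>i\<le>d. \<Sum>j\<le>d - i. monom (monom (c i j) i) j"])
       (simp add: poly_monom algebra_simps)
qed

text \<open>Its nonvanishing set is a nonempty Zariski open set. Generic conditions are carried by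
  such forms, and a product of forms imposes several of them at once.\<close>

definition nonzero_form :: "(complex^3 \<Rightarrow> complex) \<Rightarrow> bool"
  where "nonzero_form p \<longleftrightarrow> (\<exists>d. form d p) \<and> (\<exists>v. p v \<noteq> 0)"

text \<open>Forms are functions here, so the absence of zero divisors is taken from one variable:
  both are restricted to the line through a point where \<open>p\<close> is nonzero and a point
  where \<open>q\<close> is nonzero.\<close>

lemma nonzero_form_mult:
  assumes "nonzero_form p" "nonzero_form q"
  shows "nonzero_form (\<lambda>v. p v * q v)"
proof -
  obtain d e u w where d: "form d p" "form e q" and uw: "p u \<noteq> 0" "q w \<noteq> 0"
    using assms by (auto simp: nonzero_form_def)
  obtain P Q where P: "\<And>t. p (u + t *s (w - u)) = poly P t" and Q: "\<And>t. q (u + t *s (w - u)) = poly Q t"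
    using form_on_line[OF d(1)] form_on_line[OF d(2)] by metis
  have "P \<noteq> 0" using P[of 0] uw by auto
  moreover have "Q \<noteq> 0" using Q[of 1] uw by auto
  ultimately obtain t where "poly (P * Q) t \<noteq> 0"
    using poly_all_0_iff_0[of "P * Q"] by auto
  then have "p (u + t *s (w - u)) * q (u + t *s (w - u)) \<noteq> 0" using P Q by simp
  then show ?thesis
    unfolding nonzero_form_def using form_mult[OF d] by blast
qed

lemma nonzero_form_coordinate: "nonzero_form (\<lambda>v. v $ k)"
  unfolding nonzero_form_def using form_coordinate by (metis one_index zero_neq_one)

text \<open>Multiplication by the third coordinate gives a nonzero value off the line at infinity,
  and homogeneity rescales that point into the chart.\<close>

lemma nonzero_form_chart:
  assumes "nonzero_form p"
  obtains z where "p (from_chart z) \<noteq> 0"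
proof -
  obtain v where v: "p v * v $ 3 \<noteq> 0"
    using nonzero_form_mult[OF assms nonzero_form_coordinate[of 3]] by (auto simp: nonzero_form_def)
  obtain d where d: "form d p" using assms by (auto simp: nonzero_form_def)
  have "v = (v $ 3) *s from_chart (v $ 1 / v $ 3, v $ 2 / v $ 3)"
    using v by (simp add: vec_eq_iff forall_3)
  then have "p v = (v $ 3) ^ d * p (from_chart (v $ 1 / v $ 3, v $ 2 / v $ 3))"
    using form_homogeneous[OF d] by metis
  then have "p (from_chart (v $ 1 / v $ 3, v $ 2 / v $ 3)) \<noteq> 0" using v by auto
  then show ?thesis using that by blast
qed

section \<open>Proportional vectors and classes of homogeneous maps\<close>

lemma proportional_refl: "proportional u u"
  by (simp add: proportional_def)

lemma proportional_sym: "proportional u v \<Longrightarrow> proportional v u"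
  unfolding proportional_def by (metis mult.commute)

lemma proportional_scale [simp]: "proportional (c *s u) u" "proportional u (c *s u)"
  by (simp_all add: proportional_def)

lemma proportional_imp_scale:
  assumes "proportional u v" "u \<noteq> 0"
  obtains c where "v = c *s u"
proof -
  obtain k where k: "u $ k \<noteq> 0" using assms(2) by (auto simp: vec_eq_iff)
  have "v = (v $ k / u $ k) *s u"
    using assms(1) k by (auto simp: vec_eq_iff proportional_def field_simps)
  then show ?thesis using that by blast
qed

text \<open>The zero vector is proportional to every vector, so the middle one has to be nonzero.
  For triples of forms, transitivity is therefore available pointwise only off the common zeros of
  the middle triple.\<close>

lemma proportional_trans:
  assumes "proportional u v" "proportional v w" "v \<noteq> 0"
  shows "proportional u w"
proof -
  obtain a where "u = a *s v" using proportional_imp_scale[OF proportional_sym] assms by metis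
  moreover obtain b where "w = b *s v" using proportional_imp_scale assms by metis
  ultimately show ?thesis by (simp add: proportional_def)
qed

lemma from_chart_nonzero [simp]: "from_chart p \<noteq> 0"
  by (metis from_chart_nth(3) zero_index zero_neq_one)

lemma proportional_from_chart_iff: "proportional (from_chart p) (from_chart q) \<longleftrightarrow> p = q"
  by (auto simp: proportional_def forall_3 prod_eq_iff)

lemma hom_mapsE:
  assumes "f \<in> hom_maps"
  obtains d k where "\<And>k. form d (\<lambda>v. f v $ k)" "nonzero_form (\<lambda>v. f v $ k)"
proof -
  obtain d v where d: "\<And>k. form d (\<lambda>v. f v $ k)" "f v \<noteq> 0" using assms by (auto simp: hom_maps_def)
  then obtain k where "f v $ k \<noteq> 0" by (auto simp: vec_eq_iff)
  then show ?thesis using that d unfolding nonzero_form_def by blast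
qed

lemma hom_maps_forms:
  assumes "f \<in> hom_maps"
  obtains d where "\<And>k. form d (\<lambda>v. f v $ k)"
  using assms by (auto simp: hom_maps_def)

lemma hom_maps_component:
  assumes "f \<in> hom_maps"
  obtains k where "nonzero_form (\<lambda>v. f v $ k)"
  using assms by (rule hom_mapsE)

lemma hom_maps_homogeneous:
  assumes "f \<in> hom_maps"
  obtains d where "\<And>c v. f (c *s v) = c ^ d *s f v"
proof -
  obtain d where "\<And>k. form d (\<lambda>v. f v $ k)" using hom_maps_forms[OF assms] by blast
  from form_homogeneous[OF this] have "f (c *s v) = c ^ d *s f v" for c v
    by (simp add: vec_eq_iff)
  then show ?thesis using that by blast
qed

lemma proportional_hom_map:
  assumes "f \<in> hom_maps" "proportional u v"
  shows "proportional (f u) (f v)"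
proof -
  obtain d where d: "\<And>c v. f (c *s v) = c ^ d *s f v" using hom_maps_homogeneous[OF assms(1)] by blast
  have "(\<exists>c. u = c *s v) \<or> (\<exists>c. v = c *s u)"
  proof (cases "u = 0")
    case True
    then have "u = 0 *s v" by (simp add: vec_eq_iff)
    then show ?thesis by blast
  next
    case False
    then show ?thesis using proportional_imp_scale[OF assms(2)] by metis
  qed
  then show ?thesis using d by auto
qed

lemma form_minor:
  assumes "\<And>k. form d (\<lambda>v. f v $ k)" "\<And>k. form e (\<lambda>v. g v $ k)"
  shows "form (d + e) (\<lambda>v. f v $ i * g v $ j - f v $ j * g v $ i)"
  using assms by (intro form_diff form_mult)

text \<open>A minor of \<open>f\<close> and \<open>g\<close> that is not identically zero,
  multiplied by \<open>q\<close>, is again a nonzero form, so it is nonzero at some chart point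
  where \<open>q\<close> does not vanish.\<close>

lemma same_rational_mapI:
  assumes "f \<in> hom_maps" "g \<in> hom_maps" "nonzero_form q"
    and chart: "\<And>z. q (from_chart z) \<noteq> 0 \<Longrightarrow> proportional (f (from_chart z)) (g (from_chart z))"
  shows "(f, g) \<in> same_rational_map"
proof -
  have "f v $ i * g v $ j - f v $ j * g v $ i = 0" for v i j
  proof (rule ccontr)
    assume "f v $ i * g v $ j - f v $ j * g v $ i \<noteq> 0"
    moreover have "\<exists>d. form d (\<lambda>v. f v $ i * g v $ j - f v $ j * g v $ i)"
    proof -
      obtain d where d: "\<And>k. form d (\<lambda>v. f v $ k)" using hom_maps_forms[OF assms(1)] by blast
      obtain e where e: "\<And>k. form e (\<lambda>v. g v $ k)" using hom_maps_forms[OF assms(2)] by blast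
      show ?thesis using form_minor[OF d e] by blast
    qed
    ultimately have "nonzero_form (\<lambda>v. f v $ i * g v $ j - f v $ j * g v $ i)"
      unfolding nonzero_form_def by blast
    then obtain z where "q (from_chart z) *
        (f (from_chart z) $ i * g (from_chart z) $ j - f (from_chart z) $ j * g (from_chart z) $ i) \<noteq> 0"
      using nonzero_form_chart nonzero_form_mult[OF assms(3)] by blast
    then show False using chart[of z] by (auto simp: proportional_def)
  qed
  then show ?thesis using assms(1,2) by (simp add: same_rational_map_def proportional_def)
qed

lemma same_rational_mapD: "(f, g) \<in> same_rational_map \<Longrightarrow> proportional (f v) (g v)"
  by (simp add: same_rational_map_def)

lemma equiv_same_rational_map: "equiv hom_maps same_rational_map"
proof (rule equivI)
  show "same_rational_map \<subseteq> hom_maps \<times> hom_maps" by (auto simp: same_rational_map_def)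
  show "refl_on hom_maps same_rational_map"
    by (auto simp: refl_on_def same_rational_map_def proportional_refl)
  show "sym same_rational_map"
    by (auto simp: sym_def same_rational_map_def proportional_sym)
  show "trans same_rational_map"
  proof (rule transI)
    fix f g h assume fg: "(f, g) \<in> same_rational_map" and gh: "(g, h) \<in> same_rational_map"
    then have hom: "f \<in> hom_maps" "g \<in> hom_maps" "h \<in> hom_maps" by (auto simp: same_rational_map_def)
    obtain k where "nonzero_form (\<lambda>v. g v $ k)" using hom_maps_component[OF hom(2)] .
    then show "(f, h) \<in> same_rational_map"
    proof (rule same_rational_mapI[OF hom(1,3)])
      fix z assume "g (from_chart z) $ k \<noteq> 0"
      then have "g (from_chart z) \<noteq> 0" by auto
      then show "proportional (f (from_chart z)) (h (from_chart z))"
        using proportional_trans fg gh same_rational_mapD by blast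
    qed
  qed
qed

lemma rational_map_of_eq_iff:
  "f \<in> hom_maps \<Longrightarrow> g \<in> hom_maps \<Longrightarrow> rational_map_of f = rational_map_of g \<longleftrightarrow> (f, g) \<in> same_rational_map"
  unfolding rational_map_of_def using eq_equiv_class_iff[OF equiv_same_rational_map] by blast

lemma mem_rational_map_of_iff: "g \<in> rational_map_of f \<longleftrightarrow> (f, g) \<in> same_rational_map"
  by (simp add: rational_map_of_def)

lemma rational_map_of_self: "f \<in> hom_maps \<Longrightarrow> f \<in> rational_map_of f"
  by (simp add: mem_rational_map_of_iff same_rational_map_def proportional_refl)

lemma same_rational_map_hom: "(f, g) \<in> same_rational_map \<Longrightarrow> f \<in> hom_maps \<and> g \<in> hom_maps"
  by (simp add: same_rational_map_def)

lemma same_rational_map_sym: "(f, g) \<in> same_rational_map \<Longrightarrow> (g, f) \<in> same_rational_map"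
  using equiv_same_rational_map by (meson equivE symE)

lemma same_rational_map_trans:
  "(f, g) \<in> same_rational_map \<Longrightarrow> (g, h) \<in> same_rational_map \<Longrightarrow> (f, h) \<in> same_rational_map"
  using equiv_same_rational_map by (meson equivE transE)

text \<open>The image lies in no curve. This is what keeps a composite \<open>f \<circ> g\<close>
  from vanishing identically.\<close>

definition dominant :: "(complex^3 \<Rightarrow> complex^3) \<Rightarrow> bool"
  where "dominant g \<longleftrightarrow> g \<in> hom_maps \<and> (\<forall>p. nonzero_form p \<longrightarrow> nonzero_form (\<lambda>v. p (g v)))"

lemma nonzero_form_compose:
  assumes "nonzero_form p" "g \<in> hom_maps" "p (g v) \<noteq> 0"
  shows "nonzero_form (\<lambda>v. p (g v))"
proof -
  obtain d where d: "form d p" using assms by (auto simp: nonzero_form_def)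
  obtain e where e: "\<And>k. form e (\<lambda>v. g v $ k)" using hom_maps_forms[OF assms(2)] by blast
  show ?thesis unfolding nonzero_form_def using form_compose[OF d e] assms(3) by blast
qed

lemma dominant_same:
  assumes "dominant f" "(f, g) \<in> same_rational_map"
  shows "dominant g"
  unfolding dominant_def
proof (intro conjI allI impI)
  show g: "g \<in> hom_maps" using assms(2) same_rational_map_hom by blast
  fix p assume p: "nonzero_form p"
  then obtain d where d: "form d p" by (auto simp: nonzero_form_def)
  obtain k where k: "nonzero_form (\<lambda>v. g v $ k)" using hom_maps_component[OF g] .
  have "f \<in> hom_maps" using assms(1) by (simp add: dominant_def)
  then obtain l where l: "nonzero_form (\<lambda>v. f v $ l)" by (rule hom_maps_component)
  have "nonzero_form (\<lambda>v. p (f v))" using assms(1) p by (simp add: dominant_def)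
  then have "nonzero_form (\<lambda>v. (g v $ k * f v $ l) * p (f v))" using k l nonzero_form_mult by blast
  then obtain v where v: "g v $ k \<noteq> 0" "f v $ l \<noteq> 0" "p (f v) \<noteq> 0" unfolding nonzero_form_def by auto
  have "g v \<noteq> 0" using v(1) by auto
  then obtain c where c: "f v = c *s g v"
    using proportional_imp_scale[OF proportional_sym[OF same_rational_mapD[OF assms(2)]]] by metis
  then have "p (g v) \<noteq> 0" using v form_homogeneous[OF d, of c "g v"] by auto
  then show "nonzero_form (\<lambda>v. p (g v))" using nonzero_form_compose[OF p g] by blast
qed

lemma hom_maps_compose:
  assumes "f \<in> hom_maps" "dominant g"
  shows "f \<circ> g \<in> hom_maps"
proof -
  obtain d k where d: "\<And>k. form d (\<lambda>v. f v $ k)" and k: "nonzero_form (\<lambda>v. f v $ k)"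
    using hom_mapsE[OF assms(1)] by blast
  have "nonzero_form (\<lambda>v. f (g v) $ k)"
    using assms(2) k unfolding dominant_def by (auto dest: spec[of _ "\<lambda>v. f v $ k"])
  then obtain v where "f (g v) $ k \<noteq> 0" by (auto simp: nonzero_form_def)
  then have "(f \<circ> g) v \<noteq> 0" by auto
  moreover obtain e where e: "\<And>k. form e (\<lambda>v. g v $ k)"
    using hom_maps_forms assms(2) unfolding dominant_def by blast
  have "form (d * e) (\<lambda>v. (f \<circ> g) v $ k)" for k using form_compose[OF d e] by simp
  ultimately show ?thesis by (auto simp: hom_maps_def)
qed

lemma same_rational_map_compose:
  assumes "(f, f') \<in> same_rational_map" "(g, g') \<in> same_rational_map" "dominant g"
  shows "(f \<circ> g, f' \<circ> g') \<in> same_rational_map"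
proof -
  have hom: "f \<in> hom_maps" "f' \<in> hom_maps" "g \<in> hom_maps" "g' \<in> hom_maps"
    using assms same_rational_map_hom by blast+
  have dom: "dominant g'" using dominant_same assms by blast
  note fg = hom_maps_compose[OF hom(1) assms(3)] hom_maps_compose[OF hom(2) assms(3)]
    hom_maps_compose[OF hom(2) dom]
  have "(f \<circ> g, f' \<circ> g) \<in> same_rational_map"
    using fg assms(1) by (simp add: same_rational_map_def)
  moreover have "(f' \<circ> g, f' \<circ> g') \<in> same_rational_map"
    using fg assms(2) hom(2) proportional_hom_map by (simp add: same_rational_map_def)
  ultimately show ?thesis by (rule same_rational_map_trans)
qed

text \<open>At a point \<open>v\<close> where neither \<open>f \<circ> g\<close> nor
  \<open>p\<close> vanishes, \<open>v\<close> is a multiple of \<open>f (g v)\<close>. By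
  homogeneity \<open>p\<close> is nonzero at \<open>f (g v)\<close>, so \<open>g v\<close> is a
  witness.\<close>

lemma birational_dominant:
  assumes "birational f"
  shows "dominant f"
  unfolding dominant_def
proof (intro conjI allI impI)
  show f: "f \<in> hom_maps" using assms by (simp add: birational_def)
  obtain g where g: "g \<in> hom_maps" "(g \<circ> f, id) \<in> same_rational_map" "(f \<circ> g, id) \<in> same_rational_map"
    using assms by (auto simp: birational_def)
  fix p assume p: "nonzero_form p"
  then obtain d where d: "form d p" by (auto simp: nonzero_form_def)
  have "f \<circ> g \<in> hom_maps" using g(3) same_rational_map_hom by blast
  then obtain k where "nonzero_form (\<lambda>v. (f \<circ> g) v $ k)" by (rule hom_maps_component)
  then have "nonzero_form (\<lambda>v. (f \<circ> g) v $ k * p v)" using p nonzero_form_mult by blast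
  then obtain v where v: "(f \<circ> g) v $ k \<noteq> 0" "p v \<noteq> 0" unfolding nonzero_form_def by auto
  then have "(f \<circ> g) v \<noteq> 0" by auto
  then obtain c where c: "v = c *s (f \<circ> g) v"
    using proportional_imp_scale[OF same_rational_mapD[OF g(3)]] by (metis id_apply)
  then have "p v = c ^ d * p (f (g v))" using form_homogeneous[OF d] by (metis comp_apply)
  then have "p (f (g v)) \<noteq> 0" using v by auto
  then show "nonzero_form (\<lambda>v. p (f v))" using nonzero_form_compose[OF p f] by blast
qed

text \<open>All choices of representatives yield the same class for the composite, so the union in
  the definition of the product collapses to that class.\<close>

lemma Bir_P2_mult:
  assumes "f \<in> hom_maps" "dominant g"
  shows "rational_map_of f \<otimes>\<^bsub>Bir_P2\<^esub> rational_map_of g = rational_map_of (f \<circ> g)"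
proof -
  have g: "g \<in> hom_maps" using assms(2) by (simp add: dominant_def)
  have "rational_map_of (f' \<circ> g') = rational_map_of (f \<circ> g)"
    if "f' \<in> rational_map_of f" "g' \<in> rational_map_of g" for f' g'
  proof -
    have "(f \<circ> g, f' \<circ> g') \<in> same_rational_map"
      using that same_rational_map_compose assms(2) by (simp add: mem_rational_map_of_iff)
    then show ?thesis using rational_map_of_eq_iff same_rational_map_hom by metis
  qed
  then have "(\<Union>f'\<in>rational_map_of f. \<Union>g'\<in>rational_map_of g. rational_map_of (f' \<circ> g'))
      = (\<Union>f'\<in>rational_map_of f. \<Union>g'\<in>rational_map_of g. rational_map_of (f \<circ> g))"
    by (intro SUP_cong refl)
  moreover have "rational_map_of f \<noteq> {}" "rational_map_of g \<noteq> {}"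
    using rational_map_of_self[OF assms(1)] rational_map_of_self[OF g] by blast+
  ultimately show ?thesis
    by (simp add: Bir_P2_def)
qed

text \<open>Agreement on \<open>U\<close> determines the class because \<open>U\<close> contains the
  chart points where \<open>q\<close> is nonzero. Conversely \<open>g\<close> has no zeros on
  \<open>U\<close>, so by transitivity through \<open>g\<close> every triple of its class, even with
  additional common factors, passes the test at every point of \<open>U\<close>.\<close>

lemma rational_map_in_chart_eq:
  assumes "g \<in> hom_maps" "nonzero_form q" "\<And>z. q (from_chart z) \<noteq> 0 \<Longrightarrow> z \<in> U"
    and g: "\<And>z. z \<in> U \<Longrightarrow> g (from_chart z) \<noteq> 0"
      "\<And>z. z \<in> U \<Longrightarrow> proportional (g (from_chart z)) (from_chart (T z))"
  shows "rational_map_in_chart U T = rational_map_of g"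
proof (intro equalityI subsetI)
  fix f assume f: "f \<in> rational_map_in_chart U T"
  then have "f \<in> hom_maps" by (simp add: rational_map_in_chart_def)
  then have "(g, f) \<in> same_rational_map"
  proof (rule same_rational_mapI[OF assms(1) _ assms(2)])
    fix z assume "q (from_chart z) \<noteq> 0"
    then have "z \<in> U" by fact
    then show "proportional (g (from_chart z)) (f (from_chart z))"
      using f g(2) proportional_trans[OF _ proportional_sym from_chart_nonzero]
      unfolding rational_map_in_chart_def by blast
  qed
  then show "f \<in> rational_map_of g" by (simp add: mem_rational_map_of_iff)
next
  fix f assume "f \<in> rational_map_of g"
  then have f: "(g, f) \<in> same_rational_map" by (simp add: mem_rational_map_of_iff)
  then have "proportional (f (from_chart z)) (from_chart (T z))" if "z \<in> U" for z
    using proportional_trans[OF proportional_sym[OF same_rational_mapD[OF f]] g(2) g(1)] that by blast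
  then show "f \<in> rational_map_in_chart U T"
    using same_rational_map_hom[OF f] by (simp add: rational_map_in_chart_def)
qed

section \<open>Monomial maps of the torus\<close>

definition torus :: "chart set"
  where "torus = {(x, y). x \<noteq> 0 \<and> y \<noteq> 0}"

definition torus_map :: "int^2^2 \<Rightarrow> chart \<Rightarrow> chart \<Rightarrow> chart"
  where "torus_map A s p = (fst s * (fst p powi (A $ 1 $ 1) * snd p powi (A $ 1 $ 2)),
                            snd s * (fst p powi (A $ 2 $ 1) * snd p powi (A $ 2 $ 2)))"

definition torus_rational :: "int^2^2 \<Rightarrow> chart \<Rightarrow> rational_map"
  where "torus_rational A s = rational_map_in_chart torus (torus_map A s)"

lemma mem_torus_iff: "p \<in> torus \<longleftrightarrow> fst p \<noteq> 0 \<and> snd p \<noteq> 0"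
  by (cases p) (simp add: torus_def)

lemma one_in_torus: "(1, 1) \<in> torus"
  by (simp add: mem_torus_iff)

lemma torus_map_in_torus: "s \<in> torus \<Longrightarrow> p \<in> torus \<Longrightarrow> torus_map A s p \<in> torus"
  by (simp add: torus_map_def mem_torus_iff)

lemma torus_map_id [simp]: "torus_map (mat 1) s p = (fst s * fst p, snd s * snd p)"
  by (simp add: torus_map_def mat_def)

lemma torus_map_at_one [simp]: "torus_map A s (1, 1) = s"
  by (simp add: torus_map_def)

text \<open>
  Since \<open>torus_map A s t\<close> is \<open>s\<close> times the image of \<open>t\<close> under \<open>A\<close>, this is the product of
  \<open>(A, s)\<close> and \<open>(B, t)\<close> in the semidirect product of the matrices with the torus.
\<close>

lemma torus_map_compose:
  assumes "t \<in> torus" "p \<in> torus"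
  shows "torus_map A s (torus_map B t p) = torus_map (A ** B) (torus_map A s t) p"
  using assms
  by (simp add: torus_map_def mem_torus_iff matrix_matrix_mult_def sum_2 power_int_mult_distrib
      power_int_add mult_ac flip: power_int_mult)

lemma monomial_map_eq: "monomial_map A = torus_rational A (1, 1)"
proof -
  have "(\<lambda>(x, y). (x powi (A $ 1 $ 1) * y powi (A $ 1 $ 2), x powi (A $ 2 $ 1) * y powi (A $ 2 $ 2)))
      = torus_map A (1, 1)"
    by (simp add: fun_eq_iff torus_map_def)
  then show ?thesis by (simp add: monomial_map_def torus_rational_def torus_def)
qed

text \<open>
  The monomial map multiplied by \<open>x\<^sup>n y\<^sup>n\<close> to clear negative exponents, and then homogenized
  to degree \<open>4 n\<close>; no exponent is truncated, because \<open>n\<close> bounds the exponents of the matrix.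
\<close>

definition monomial_form :: "int^2^2 \<Rightarrow> chart \<Rightarrow> complex^3 \<Rightarrow> complex^3"
  where "monomial_form A s v =
    (let n = nat (\<bar>A $ 1 $ 1\<bar> + \<bar>A $ 1 $ 2\<bar> + \<bar>A $ 2 $ 1\<bar> + \<bar>A $ 2 $ 2\<bar>);
         m = (\<lambda>a b. (v $ 1) ^ nat (int n + a) * (v $ 2) ^ nat (int n + b) * (v $ 3) ^ nat (2 * int n - a - b))
     in vector [fst s * m (A $ 1 $ 1) (A $ 1 $ 2), snd s * m (A $ 2 $ 1) (A $ 2 $ 2), m 0 0])"

lemma monomial_form_in_chart:
  assumes "p \<in> torus"
  obtains c where "c \<noteq> 0" "monomial_form A s (from_chart p) = c *s from_chart (torus_map A s p)"
proof -
  define n where "n = nat (\<bar>A $ 1 $ 1\<bar> + \<bar>A $ 1 $ 2\<bar> + \<bar>A $ 2 $ 1\<bar> + \<bar>A $ 2 $ 2\<bar>)"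
  have pow: "x ^ nat (int n + a) = x ^ n * x powi a" if "x \<noteq> 0" "int n + a \<ge> 0" for x :: complex and a
  proof -
    have "x ^ nat (int n + a) = x powi (int n + a)"
      using that(2) by (metis nat_0_le power_int_of_nat)
    then show ?thesis using that(1) by (simp add: power_int_add)
  qed
  have nonneg: "int n + A $ 1 $ 1 \<ge> 0" "int n + A $ 1 $ 2 \<ge> 0" "int n + A $ 2 $ 1 \<ge> 0" "int n + A $ 2 $ 2 \<ge> 0"
    unfolding n_def by linarith+
  have "monomial_form A s (from_chart p) = (fst p ^ n * snd p ^ n) *s from_chart (torus_map A s p)"
    using assms nonneg
    by (simp add: monomial_form_def Let_def pow flip: n_def)
       (simp add: vec_eq_iff forall_3 torus_map_def mem_torus_iff pow)
  moreover have "fst p ^ n * snd p ^ n \<noteq> 0" using assms by (simp add: mem_torus_iff)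
  ultimately show ?thesis using that by blast
qed

lemma torus_generic: "nonzero_form (\<lambda>v. v $ 1 * v $ 2)" "from_chart z $ 1 * from_chart z $ 2 \<noteq> 0 \<Longrightarrow> z \<in> torus"
  using nonzero_form_mult nonzero_form_coordinate by (auto simp: mem_torus_iff)

lemma monomial_form_hom: "monomial_form A s \<in> hom_maps"
proof -
  define n where "n = nat (\<bar>A $ 1 $ 1\<bar> + \<bar>A $ 1 $ 2\<bar> + \<bar>A $ 2 $ 1\<bar> + \<bar>A $ 2 $ 2\<bar>)"
  have mon: "form (4 * n) (\<lambda>v. e * ((v $ 1) ^ nat (int n + a) * (v $ 2) ^ nat (int n + b) * (v $ 3) ^ nat (2 * int n - a - b)))"
    if "\<bar>a\<bar> + \<bar>b\<bar> \<le> int n" for a b e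
    using that by (intro form_cmult form_monomial) linarith
  have "form (4 * n) (\<lambda>v. monomial_form A s v $ k)" for k
  proof -
    have "form (4 * n) (\<lambda>v. monomial_form A s v $ 1)" "form (4 * n) (\<lambda>v. monomial_form A s v $ 2)"
      "form (4 * n) (\<lambda>v. monomial_form A s v $ 3)"
      using mon[of "A $ 1 $ 1" "A $ 1 $ 2" "fst s"] mon[of "A $ 2 $ 1" "A $ 2 $ 2" "snd s"] mon[of 0 0 1]
      by (simp_all add: monomial_form_def Let_def flip: n_def) (simp_all add: n_def)
    then show ?thesis using exhaust_3[of k] by auto
  qed
  moreover have "\<exists>v. monomial_form A s v \<noteq> 0"
    using monomial_form_in_chart[OF one_in_torus, of A s] by (metis from_chart_nonzero vector_mul_eq_0)
  ultimately show ?thesis unfolding hom_maps_def by blast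
qed

lemma torus_rational_eq: "torus_rational A s = rational_map_of (monomial_form A s)"
  unfolding torus_rational_def
proof (rule rational_map_in_chart_eq[OF monomial_form_hom torus_generic])
  fix z assume "z \<in> torus"
  then obtain c where "c \<noteq> 0" "monomial_form A s (from_chart z) = c *s from_chart (torus_map A s z)"
    using monomial_form_in_chart by blast
  then show "monomial_form A s (from_chart z) \<noteq> 0"
    "proportional (monomial_form A s (from_chart z)) (from_chart (torus_map A s z))"
    by simp_all
qed

lemma monomial_form_compose_in_chart:
  assumes "t \<in> torus" "p \<in> torus"
  obtains c where "c \<noteq> 0"
    "(monomial_form A s \<circ> monomial_form B t) (from_chart p) = c *s from_chart (torus_map (A ** B) (torus_map A s t) p)"
proof -
  obtain b where b: "b \<noteq> 0" "monomial_form B t (from_chart p) = b *s from_chart (torus_map B t p)"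
    using monomial_form_in_chart[OF assms(2)] by blast
  obtain a where a: "a \<noteq> 0" "monomial_form A s (from_chart (torus_map B t p))
      = a *s from_chart (torus_map A s (torus_map B t p))"
    using monomial_form_in_chart[OF torus_map_in_torus[OF assms]] by blast
  obtain d where d: "\<And>c v. monomial_form A s (c *s v) = c ^ d *s monomial_form A s v"
    using hom_maps_homogeneous[OF monomial_form_hom] by blast
  have "(monomial_form A s \<circ> monomial_form B t) (from_chart p)
      = (b ^ d * a) *s from_chart (torus_map (A ** B) (torus_map A s t) p)"
    using assms by (simp add: a b d torus_map_compose)
  then show ?thesis using that[of "b ^ d * a"] a(1) b(1) by simp
qed

text \<open>Dominance cannot be quoted, as it will be derived from birationality, which rests on
  this lemma. Instead the point (1, 1) stays in the torus under both maps and shows that the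
  composite is not zero.\<close>

lemma monomial_form_compose_hom:
  assumes "t \<in> torus"
  shows "monomial_form A s \<circ> monomial_form B t \<in> hom_maps"
proof -
  obtain d where d: "\<And>k. form d (\<lambda>v. monomial_form A s v $ k)"
    using hom_maps_forms[OF monomial_form_hom] by blast
  obtain e where e: "\<And>k. form e (\<lambda>v. monomial_form B t v $ k)"
    using hom_maps_forms[OF monomial_form_hom] by blast
  have "form (d * e) (\<lambda>v. (monomial_form A s \<circ> monomial_form B t) v $ k)" for k
    using form_compose[OF d e] by simp
  moreover have "\<exists>v. (monomial_form A s \<circ> monomial_form B t) v \<noteq> 0"
    using monomial_form_compose_in_chart[OF assms one_in_torus, of A s B]
    by (metis from_chart_nonzero vector_mul_eq_0)
  ultimately show ?thesis unfolding hom_maps_def by blast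
qed

lemma torus_rational_compose:
  assumes "t \<in> torus"
  shows "torus_rational (A ** B) (torus_map A s t) = rational_map_of (monomial_form A s \<circ> monomial_form B t)"
  unfolding torus_rational_def
proof (rule rational_map_in_chart_eq[OF monomial_form_compose_hom[OF assms] torus_generic])
  fix z assume "z \<in> torus"
  then obtain c where "c \<noteq> 0" "(monomial_form A s \<circ> monomial_form B t) (from_chart z)
      = c *s from_chart (torus_map (A ** B) (torus_map A s t) z)"
    using monomial_form_compose_in_chart[OF assms] by blast
  then show "(monomial_form A s \<circ> monomial_form B t) (from_chart z) \<noteq> 0"
    "proportional ((monomial_form A s \<circ> monomial_form B t) (from_chart z))
       (from_chart (torus_map (A ** B) (torus_map A s t) z))"
    by simp_all
qed

section \<open>Identity and inverses of the torus maps\<close>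

lemma id_hom: "id \<in> hom_maps"
  unfolding hom_maps_def using form_coordinate by (auto intro: exI[of _ "from_chart 0"] exI[of _ 1])

lemma torus_rational_id: "torus_rational (mat 1) (1, 1) = rational_map_of id"
  unfolding torus_rational_def
  by (rule rational_map_in_chart_eq[OF id_hom torus_generic]) (simp_all add: proportional_refl)

definition adjugate :: "int^2^2 \<Rightarrow> int^2^2"
  where "adjugate A = vector [vector [A $ 2 $ 2, - A $ 1 $ 2], vector [- A $ 2 $ 1, A $ 1 $ 1]]"

lemma adjugate_nth [simp]:
  "adjugate A $ 1 $ 1 = A $ 2 $ 2" "adjugate A $ 1 $ 2 = - A $ 1 $ 2"
  "adjugate A $ 2 $ 1 = - A $ 2 $ 1" "adjugate A $ 2 $ 2 = A $ 1 $ 1"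
  by (simp_all add: adjugate_def)

lemma adjugate:
  assumes "det A = 1"
  shows "adjugate A ** A = mat 1" "A ** adjugate A = mat 1" "det (adjugate A) = 1"
  using assms by (auto simp: vec_eq_iff forall_2 matrix_matrix_mult_def sum_2 mat_def det_2 algebra_simps)

text \<open>In the semidirect product of matrices and torus the inverse of \<open>(A, s)\<close> has
  torus part \<open>t\<close>, the image of the inverse of \<open>s\<close> under the inverse
  matrix.\<close>

lemma torus_inverse:
  assumes "det A = 1" "s \<in> torus"
  obtains t where "t \<in> torus" "torus_map A s t = (1, 1)" "torus_map (adjugate A) t s = (1, 1)"
proof
  let ?s = "(inverse (fst s), inverse (snd s))"
  let ?t = "torus_map (adjugate A) (1, 1) ?s"
  have s: "?s \<in> torus" using assms(2) by (simp add: mem_torus_iff)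
  show "?t \<in> torus" using s by (simp add: torus_map_in_torus one_in_torus)
  have "torus_map A s ?t = torus_map (mat 1) s ?s"
    using torus_map_compose[OF one_in_torus s, of A s "adjugate A"] by (simp add: adjugate[OF assms(1)])
  then show "torus_map A s ?t = (1, 1)"
    using assms(2) by (simp add: mem_torus_iff)
  show "torus_map (adjugate A) ?t s = (1, 1)"
    using assms(2) by (simp add: torus_map_def mem_torus_iff divide_simps)
qed

lemma birational_monomial_form:
  assumes "det A = 1" "s \<in> torus"
  shows "birational (monomial_form A s)"
proof -
  obtain t where t: "t \<in> torus" "torus_map A s t = (1, 1)" "torus_map (adjugate A) t s = (1, 1)"
    using torus_inverse[OF assms] .
  have "rational_map_of (monomial_form A s \<circ> monomial_form (adjugate A) t) = rational_map_of id"
    using torus_rational_compose[OF t(1), of A "adjugate A" s] t(2) torus_rational_id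
    by (simp add: adjugate[OF assms(1)])
  moreover have "rational_map_of (monomial_form (adjugate A) t \<circ> monomial_form A s) = rational_map_of id"
    using torus_rational_compose[OF assms(2), of "adjugate A" A t] t(3) torus_rational_id
    by (simp add: adjugate[OF assms(1)])
  ultimately show ?thesis
    unfolding birational_def
    using rational_map_of_eq_iff id_hom monomial_form_compose_hom assms(2) t(1) monomial_form_hom
    by blast
qed

lemma torus_rational_mult:
  assumes "det B = 1" "t \<in> torus"
  shows "torus_rational A s \<otimes>\<^bsub>Bir_P2\<^esub> torus_rational B t = torus_rational (A ** B) (torus_map A s t)"
  unfolding torus_rational_compose[OF assms(2)]
  unfolding torus_rational_eq
  by (rule Bir_P2_mult[OF monomial_form_hom birational_dominant[OF birational_monomial_form[OF assms]]])

lemma torus_rational_in_Bir_P2: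
  assumes "det A = 1" "s \<in> torus"
  shows "torus_rational A s \<in> carrier Bir_P2"
  using birational_monomial_form[OF assms] by (auto simp: Bir_P2_def torus_rational_eq)

text \<open>The value at (1, 1) is the torus part. The values at (2, 1) and (1, 2) show the two
  columns of the matrix as exponents of 2.\<close>

lemma torus_rational_inject:
  assumes "s \<in> torus" "t \<in> torus"
  shows "torus_rational A s = torus_rational B t \<longleftrightarrow> A = B \<and> s = t"
proof
  assume eq: "torus_rational A s = torus_rational B t"
  have map_eq: "torus_map A s p = torus_map B t p" if p: "p \<in> torus" for p
  proof -
    have "monomial_form A s \<in> torus_rational B t"
      unfolding eq[symmetric] unfolding torus_rational_eq by (rule rational_map_of_self[OF monomial_form_hom])
    then have "proportional (monomial_form A s (from_chart p)) (from_chart (torus_map B t p))"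
      using p by (simp add: torus_rational_def rational_map_in_chart_def)
    moreover obtain c where "c \<noteq> 0" "monomial_form A s (from_chart p) = c *s from_chart (torus_map A s p)"
      using monomial_form_in_chart[OF p] by blast
    ultimately have "proportional (from_chart (torus_map A s p)) (from_chart (torus_map B t p))"
      using proportional_trans by (metis from_chart_nonzero proportional_scale(2) vector_mul_eq_0)
    then show ?thesis by (simp add: proportional_from_chart_iff)
  qed
  have "s = t" using map_eq[OF one_in_torus] by simp
  have inj: "a = b" if "(2::complex) powi a = 2 powi b" for a b
  proof -
    have "norm ((2::complex) powi a) = norm ((2::complex) powi b)" using that by simp
    then have "(2::real) powi a = 2 powi b" by (simp add: norm_power_int)
    then show ?thesis
      using power_int_strict_increasing[of a b "2::real"] power_int_strict_increasing[of b a "2::real"]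
      by (cases a b rule: linorder_cases) auto
  qed
  have "(2, 1) \<in> torus" "(1, 2) \<in> torus" by (simp_all add: mem_torus_iff)
  from this[THEN map_eq] have "A $ i $ j = B $ i $ j" for i j
    using assms \<open>s = t\<close> exhaust_2[of i] exhaust_2[of j]
    by (auto simp: torus_map_def mem_torus_iff dest!: inj)
  then show "A = B \<and> s = t" using \<open>s = t\<close> by (simp add: vec_eq_iff)
qed simp

text \<open>Flows are tested on the whole chart and monomial maps only on the torus. A diagonal
  linear map has no zeros in the chart, so both tests give the same class.\<close>

lemma torus_rational_linear:
  assumes "s \<in> torus"
  shows "rational_map_in_chart UNIV (\<lambda>p. (fst s * fst p, snd s * snd p)) = torus_rational (mat 1) s"
    and "torus_rational (mat 1) s \<in> PGL3"
proof -
  define M :: "complex^3^3" where "M = (\<chi> i j. if i = j then vector [fst s, snd s, 1] $ i else 0)"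
  have nth: "(M *v v) $ 1 = fst s * v $ 1" "(M *v v) $ 2 = snd s * v $ 2" "(M *v v) $ 3 = v $ 3" for v
    by (simp_all add: M_def matrix_vector_mult_def sum_3)
  have "form 1 (\<lambda>v. (M *v v) $ k)" for k
  proof -
    have "form 1 (\<lambda>v. (M *v v) $ 1)" "form 1 (\<lambda>v. (M *v v) $ 2)" "form 1 (\<lambda>v. (M *v v) $ 3)"
      unfolding nth by (intro form_cmult form_coordinate)+
    then show ?thesis using exhaust_3[of k] by auto
  qed
  have chart: "M *v from_chart p = from_chart (fst s * fst p, snd s * snd p)" for p
    by (simp add: vec_eq_iff forall_3 nth)
  then have "M *v from_chart (1, 1) \<noteq> 0" by simp
  then have hom: "(\<lambda>v. M *v v) \<in> hom_maps"
    using \<open>\<And>k. form 1 (\<lambda>v. (M *v v) $ k)\<close> unfolding hom_maps_def by blast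
  have 1: "rational_map_in_chart UNIV (\<lambda>p. (fst s * fst p, snd s * snd p)) = rational_map_of (\<lambda>v. M *v v)"
    by (rule rational_map_in_chart_eq[OF hom torus_generic(1)]) (simp_all add: chart proportional_refl)
  have 2: "torus_rational (mat 1) s = rational_map_of (\<lambda>v. M *v v)"
    unfolding torus_rational_def
    by (rule rational_map_in_chart_eq[OF hom torus_generic]) (simp_all add: chart proportional_refl)
  show "rational_map_in_chart UNIV (\<lambda>p. (fst s * fst p, snd s * snd p)) = torus_rational (mat 1) s"
    using 1 2 by simp
  have "det M \<noteq> 0" using assms by (simp add: M_def det_3 mem_torus_iff)
  then show "torus_rational (mat 1) s \<in> PGL3" using 2 unfolding PGL3_def by blast
qed

section \<open>Monomial maps preserve the foliation\<close>

lemma poly_fst_has_derivative: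
  "((\<lambda>p. poly a (fst p)) has_derivative (\<lambda>h. poly (pderiv a) (fst z) * fst h)) (at (z :: chart))"
proof -
  have "(poly a has_derivative (\<lambda>h. poly (pderiv a) (fst z) * h)) (at (fst z))"
    using poly_DERIV[of a "fst z"] by (simp add: has_field_derivative_def)
  from has_derivative_compose[OF has_derivative_fst[OF has_derivative_ident] this] show ?thesis .
qed

lemma eval2_has_derivative:
  "((\<lambda>p. eval2 P (fst p) (snd p)) has_derivative
     (\<lambda>h. eval2 (map_poly pderiv P) (fst z) (snd z) * fst h + eval2 (pderiv P) (fst z) (snd z) * snd h)) (at z)"
proof (induction P)
  case 0
  show ?case by simp
next
  case (pCons a P)
  show ?case
    unfolding eval2_simps(8)
    by (rule has_derivative_eq_rhs[OF has_derivative_add[OF poly_fst_has_derivative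
          has_derivative_mult[OF has_derivative_snd[OF has_derivative_ident] pCons.IH]]])
       (simp add: map_poly_pCons pderiv_pCons fun_eq_iff algebra_simps)
qed

lemma eval2_euler_deriv:
  "eval2 (euler_deriv \<tau> P) x y
     = \<tau> * x * eval2 (map_poly pderiv P) x y + y * eval2 (pderiv P) x y"
  by (simp add: euler_deriv_def)

definition expressed_in_chart where
  "expressed_in_chart f P Q R \<longleftrightarrow>
     (\<forall>z. f (from_chart z) $ 1 = eval2 P (fst z) (snd z) \<and> f (from_chart z) $ 2 = eval2 Q (fst z) (snd z) \<and>
          f (from_chart z) $ 3 = eval2 R (fst z) (snd z))"

lemma expressed_in_chartE:
  assumes "f \<in> hom_maps"
  obtains P Q R where "expressed_in_chart f P Q R"
proof -
  obtain d where d: "\<And>k. form d (\<lambda>v. f v $ k)" using hom_maps_forms[OF assms] by blast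
  obtain P where P: "\<And>x y. f (from_chart (x, y)) $ 1 = eval2 P x y"
    using form_in_chart[OF d[of 1]] by blast
  obtain Q where Q: "\<And>x y. f (from_chart (x, y)) $ 2 = eval2 Q x y"
    using form_in_chart[OF d[of 2]] by blast
  obtain R where R: "\<And>x y. f (from_chart (x, y)) $ 3 = eval2 R x y"
    using form_in_chart[OF d[of 3]] by blast
  have "expressed_in_chart f P Q R"
    unfolding expressed_in_chart_def using P Q R by auto
  then show ?thesis using that by blast
qed

lemma mem_chart_dom_iff:
  "expressed_in_chart f P Q R \<Longrightarrow> z \<in> chart_dom f \<longleftrightarrow> eval2 R (fst z) (snd z) \<noteq> 0"
  by (cases z) (simp add: chart_dom_def expressed_in_chart_def)

lemma chart_map_eq:
  "expressed_in_chart f P Q R \<Longrightarrow> chart_map f z =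
     (eval2 P (fst z) (snd z) / eval2 R (fst z) (snd z), eval2 Q (fst z) (snd z) / eval2 R (fst z) (snd z))"
  by (cases z) (simp add: chart_map_def expressed_in_chart_def Let_def)

lemma chart_map_has_derivative:
  assumes f: "expressed_in_chart f P Q R" and z: "z \<in> chart_dom f"
  defines "d \<equiv> \<lambda>P h. eval2 (map_poly pderiv P) (fst z) (snd z) * fst h + eval2 (pderiv P) (fst z) (snd z) * snd h"
  defines "q \<equiv> \<lambda>P h. (d P h * eval2 R (fst z) (snd z) - eval2 P (fst z) (snd z) * d R h)
        / (eval2 R (fst z) (snd z) * eval2 R (fst z) (snd z))"
  shows "(chart_map f has_derivative (\<lambda>h. (q P h, q Q h))) (at z)"
proof -
  have R: "eval2 R (fst z) (snd z) \<noteq> 0" using z mem_chart_dom_iff[OF f] by simp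
  have q: "((\<lambda>z. eval2 P (fst z) (snd z) / eval2 R (fst z) (snd z)) has_derivative q P) (at z)" for P
    unfolding q_def d_def by (rule has_derivative_divide'[OF eval2_has_derivative eval2_has_derivative R])
  have "chart_map f = (\<lambda>z. (eval2 P (fst z) (snd z) / eval2 R (fst z) (snd z), eval2 Q (fst z) (snd z) / eval2 R (fst z) (snd z)))"
    using chart_map_eq[OF f] by (simp add: fun_eq_iff)
  then show ?thesis
    using has_derivative_Pair[OF q q] by simp
qed

text \<open>In the direction X_\<tau> the partial derivatives combine into
  \<open>euler_deriv\<close>, and the quotient rule becomes a statement about polynomials. The
  scalar \<open>c\<close> runs through the tangent line.\<close>

lemma chart_map_derivative_euler:
  assumes f: "expressed_in_chart f P Q R" and z: "z \<in> chart_dom f"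
    and D: "(chart_map f has_derivative D) (at z)"
  shows "D (c * (\<tau> * fst z), c * snd z) =
       (c * eval2 (euler_deriv \<tau> P * R - P * euler_deriv \<tau> R) (fst z) (snd z) / (eval2 R (fst z) (snd z))\<^sup>2,
        c * eval2 (euler_deriv \<tau> Q * R - Q * euler_deriv \<tau> R) (fst z) (snd z) / (eval2 R (fst z) (snd z))\<^sup>2)"
proof -
  have R: "eval2 R (fst z) (snd z) \<noteq> 0" using z mem_chart_dom_iff[OF f] by simp
  show ?thesis
    unfolding has_derivative_unique[OF D chart_map_has_derivative[OF f z]]
    using R by (simp add: eval2_euler_deriv field_simps power2_eq_square)
qed

lemma L_foliation_eq: "L_foliation \<tau> p = {(c * (\<tau> * fst p), c * snd p) | c. True}"
  by (simp add: L_foliation_def foliation_of_def X_field_def split_def)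

lemma regular_points_L:
  assumes "\<tau> \<noteq> 0"
  shows "regular_points (L_foliation \<tau>) = - {(0, 0)}"
proof -
  have "L_foliation \<tau> p = {0} \<longleftrightarrow> p = (0, 0)" for p
  proof
    assume *: "L_foliation \<tau> p = {0}"
    have "(\<tau> * fst p, snd p) \<in> L_foliation \<tau> p" unfolding L_foliation_eq by (auto intro: exI[of _ 1])
    then show "p = (0, 0)" using * assms by (simp add: prod_eq_iff zero_prod_def)
  qed (auto simp: L_foliation_eq zero_prod_def)
  then show ?thesis by (auto simp: regular_points_def)
qed

text \<open>Fixing \<tau> means that (\<tau>, 1) is an eigenvector of the matrix, with the
  denominator of the Moebius map as eigenvalue. A vanishing denominator would force the lower row to
  be zero.\<close>

lemma I_stab_iff:
  assumes "Im \<tau> > 0"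
  shows "A \<in> I_stab \<tau> \<longleftrightarrow> det A = 1 \<and>
     of_int (A $ 1 $ 1) * \<tau> + of_int (A $ 1 $ 2) = \<tau> * (of_int (A $ 2 $ 1) * \<tau> + of_int (A $ 2 $ 2))"
    and "det A = 1 \<Longrightarrow> of_int (A $ 2 $ 1) * \<tau> + of_int (A $ 2 $ 2) \<noteq> 0"
proof -
  show nz: "of_int (A $ 2 $ 1) * \<tau> + of_int (A $ 2 $ 2) \<noteq> 0" if "det A = 1"
  proof
    assume *: "of_int (A $ 2 $ 1) * \<tau> + of_int (A $ 2 $ 2) = 0"
    then have "Im (of_int (A $ 2 $ 1) * \<tau> + of_int (A $ 2 $ 2)) = 0" by simp
    then have "A $ 2 $ 1 = 0" using assms by simp
    moreover from this * have "A $ 2 $ 2 = 0" by simp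
    ultimately show False using that by (simp add: det_2)
  qed
  show "A \<in> I_stab \<tau> \<longleftrightarrow> det A = 1 \<and>
     of_int (A $ 1 $ 1) * \<tau> + of_int (A $ 1 $ 2) = \<tau> * (of_int (A $ 2 $ 1) * \<tau> + of_int (A $ 2 $ 2))"
    using nz by (auto simp: I_stab_def stabilizer_def SL2Z_def moebius_SL2Z_def divide_eq_eq)
qed

text \<open>P/R equals T/T', a quotient of eigenvectors, so its logarithmic derivative is l - l'.
  \<open>P\<close> and \<open>R\<close> stay general because preservation concerns every
  representative of a class.\<close>

lemma euler_deriv_of_proportional:
  assumes "P * T' = R * T" "T' \<noteq> 0"
    and eig: "euler_deriv \<tau> T = [:[:l:]:] * T" "euler_deriv \<tau> T' = [:[:l':]:] * T'"
  shows "euler_deriv \<tau> P * R - P * euler_deriv \<tau> R = [:[:l - l':]:] * (P * R)"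
proof -
  let ?D = "euler_deriv \<tau>"
  have "?D P * T' + P * ([:[:l':]:] * T') = ?D R * T + R * ([:[:l:]:] * T)"
    using arg_cong[OF assms(1), of ?D] unfolding euler_deriv_mult eig .
  \<comment> \<open>The factor \<open>R\<close> produces \<open>R * T\<close>, which is replaced by
    \<open>P * T'\<close>; then \<open>T'\<close> cancels.\<close>
  then have "R * (?D P * T' + P * ([:[:l':]:] * T')) = ?D R * (R * T) + [:[:l:]:] * R * (R * T)"
    by (simp only: algebra_simps)
  also have "\<dots> = (?D R + [:[:l:]:] * R) * P * T'"
    unfolding assms(1)[symmetric] by (simp only: algebra_simps)
  finally have *: "(R * (?D P + [:[:l':]:] * P)) * T' = ((?D R + [:[:l:]:] * R) * P) * T'"
    by (simp only: algebra_simps)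
  have "R * (?D P + [:[:l':]:] * P) = (?D R + [:[:l:]:] * R) * P"
    using * assms(2) by (simp only: mult_cancel_right) simp
  moreover have "[:[:l:]:] = [:[:l':]:] + [:[:l - l':]:]" by simp
  moreover have "X * R - P * Y = e * (P * R)" if "R * (X + m * P) = (Y + (m + e) * R) * P"
    for X Y m e :: "complex poly poly"
    using that by (simp add: algebra_simps)
  ultimately show ?thesis by metis
qed

text \<open>For every representative the differential sends X_\<tau> at \<open>z\<close> to \<mu>
  X_\<tau> at the image point, where \<mu> is the eigenvalue of \<open>A\<close> on (\<tau>, 1).
  Since \<mu> is nonzero, lines go onto lines.\<close>

lemma torus_rational_preserves:
  assumes \<tau>: "Im \<tau> > 0" and A: "A \<in> I_stab \<tau>" and s: "s \<in> torus"
  shows "preserves_foliation (torus_rational A s) (L_foliation \<tau>)"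
  unfolding preserves_foliation_def
proof (intro ballI allI impI)
  fix f z D
  assume f: "f \<in> torus_rational A s" and z: "z \<in> chart_dom f \<inter> regular_points (L_foliation \<tau>)"
    and D: "(chart_map f has_derivative D) (at z)"
  have same: "(monomial_form A s, f) \<in> same_rational_map"
    using f by (simp add: torus_rational_eq mem_rational_map_of_iff)
  obtain P Q R where PQR: "expressed_in_chart f P Q R"
    using expressed_in_chartE same_rational_map_hom[OF same] by blast
  define n where "n = nat (\<bar>A $ 1 $ 1\<bar> + \<bar>A $ 1 $ 2\<bar> + \<bar>A $ 2 $ 1\<bar> + \<bar>A $ 2 $ 2\<bar>)"
  define T where "T = (\<lambda>c a b. monom (monom c (nat (int n + a))) (nat (int n + b)) :: complex poly poly)"
  have nonneg: "int n + A $ 1 $ 1 \<ge> 0" "int n + A $ 1 $ 2 \<ge> 0" "int n + A $ 2 $ 1 \<ge> 0" "int n + A $ 2 $ 2 \<ge> 0"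
    unfolding n_def by linarith+
  have m: "monomial_form A s (from_chart (x, y)) $ 1 = eval2 (T (fst s) (A $ 1 $ 1) (A $ 1 $ 2)) x y"
    "monomial_form A s (from_chart (x, y)) $ 2 = eval2 (T (snd s) (A $ 2 $ 1) (A $ 2 $ 2)) x y"
    "monomial_form A s (from_chart (x, y)) $ 3 = eval2 (T 1 0 0) x y" for x y
    by (simp_all add: monomial_form_def Let_def T_def poly_monom flip: n_def)
  have e: "f (from_chart (x, y)) $ 1 = eval2 P x y" "f (from_chart (x, y)) $ 2 = eval2 Q x y"
    "f (from_chart (x, y)) $ 3 = eval2 R x y" for x y
    using PQR by (simp_all add: expressed_in_chart_def)
  have minor: "f v $ i * monomial_form A s v $ j = f v $ j * monomial_form A s v $ i" for v i j
    using same_rational_mapD[OF same_rational_map_sym[OF same]] by (simp add: proportional_def)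
  have P: "P * T 1 0 0 = R * T (fst s) (A $ 1 $ 1) (A $ 1 $ 2)"
    by (rule eval2_eqI) (simp only: eval2_simps(5) flip: m e, rule minor)
  have Q: "Q * T 1 0 0 = R * T (snd s) (A $ 2 $ 1) (A $ 2 $ 2)"
    by (rule eval2_eqI) (simp only: eval2_simps(5) flip: m e, rule minor)
  have T0: "T 1 0 0 \<noteq> 0" by (simp add: T_def)
  \<comment> \<open>The factor x^n y^n that clears denominators contributes n (\<tau> + 1) to all
    three eigenvalues and cancels in the quotients.\<close>
  have eig: "euler_deriv \<tau> (T c a b) = [:[:of_nat n * (\<tau> + 1) + (of_int a * \<tau> + of_int b):]:] * T c a b"
    if "int n + a \<ge> 0" "int n + b \<ge> 0" for c a b
  proof -
    have *: "of_nat (nat (int n + a)) = (of_nat n + of_int a :: complex)" if "int n + a \<ge> 0" for a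
      using that by (metis of_int_add of_int_of_nat_eq of_nat_nat)
    show ?thesis
      unfolding T_def euler_deriv_monom *[OF that(1)] *[OF that(2)] by (simp add: algebra_simps)
  qed
  have eig0: "euler_deriv \<tau> (T 1 0 0) = [:[:of_nat n * (\<tau> + 1):]:] * T 1 0 0"
    using eig[of 0 0 1] by simp
  define \<mu> where "\<mu> = of_int (A $ 2 $ 1) * \<tau> + of_int (A $ 2 $ 2)"
  have \<mu>: "\<mu> \<noteq> 0" "of_int (A $ 1 $ 1) * \<tau> + of_int (A $ 1 $ 2) = \<tau> * \<mu>"
    using A I_stab_iff[OF \<tau>] by (auto simp: \<mu>_def)
  have DP: "euler_deriv \<tau> P * R - P * euler_deriv \<tau> R = [:[:\<tau> * \<mu>:]:] * (P * R)"
    using euler_deriv_of_proportional[OF P T0 eig[OF nonneg(1,2)] eig0] by (simp add: \<mu>(2))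
  have DQ: "euler_deriv \<tau> Q * R - Q * euler_deriv \<tau> R = [:[:\<mu>:]:] * (Q * R)"
    using euler_deriv_of_proportional[OF Q T0 eig[OF nonneg(3,4)] eig0] by (simp add: \<mu>_def)
  have R: "eval2 R (fst z) (snd z) \<noteq> 0" using z mem_chart_dom_iff[OF PQR] by simp
  have scale: "D (c * (\<tau> * fst z), c * snd z)
      = (c * \<mu> * (\<tau> * fst (chart_map f z)), c * \<mu> * snd (chart_map f z))" for c
    unfolding chart_map_derivative_euler[OF PQR IntD1[OF z] D] DP DQ chart_map_eq[OF PQR]
    using R by (simp add: power2_eq_square)
  show "D ` L_foliation \<tau> z = L_foliation \<tau> (chart_map f z)"
  proof (intro equalityI subsetI)
    fix w assume "w \<in> D ` L_foliation \<tau> z"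
    then show "w \<in> L_foliation \<tau> (chart_map f z)"
      unfolding L_foliation_eq using scale by auto
  next
    fix w assume "w \<in> L_foliation \<tau> (chart_map f z)"
    then obtain c where "w = (c * (\<tau> * fst (chart_map f z)), c * snd (chart_map f z))"
      unfolding L_foliation_eq by auto
    then have "w = D (c / \<mu> * (\<tau> * fst z), c / \<mu> * snd z)"
      using \<mu>(1) by (simp only: scale) simp
    then show "w \<in> D ` L_foliation \<tau> z"
      unfolding L_foliation_eq by blast
  qed
qed

section \<open>Birational maps that preserve the foliation\<close>

lemma birational_same:
  assumes "birational f" "(f, f') \<in> same_rational_map"
  shows "birational f'"
proof -
  obtain g where g: "g \<in> hom_maps" "(f \<circ> g, id) \<in> same_rational_map" "(g \<circ> f, id) \<in> same_rational_map"
    and f: "f \<in> hom_maps"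
    using assms(1) by (auto simp: birational_def)
  have "birational g" using f g by (auto simp: birational_def)
  have gg: "(g, g) \<in> same_rational_map" using g(1) by (simp add: same_rational_map_def proportional_refl)
  have "(f' \<circ> g, id) \<in> same_rational_map"
    using same_rational_map_trans[OF same_rational_map_sym[OF
        same_rational_map_compose[OF assms(2) gg birational_dominant[OF \<open>birational g\<close>]]] g(2)] .
  moreover have "(g \<circ> f', id) \<in> same_rational_map"
    using same_rational_map_trans[OF same_rational_map_sym[OF
        same_rational_map_compose[OF gg assms(2) birational_dominant[OF assms(1)]]] g(3)] .
  ultimately show ?thesis
    using g(1) same_rational_map_hom[OF assms(2)] by (auto simp: birational_def)
qed

lemma open_eval2_nonzero: "open {z. eval2 P (fst z) (snd z) \<noteq> 0}"
proof -
  have "continuous_on UNIV (\<lambda>z. eval2 P (fst z) (snd z))"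
    using eval2_has_derivative has_derivative_continuous by (blast intro: continuous_at_imp_continuous_on)
  then show ?thesis by (intro open_Collect_neq continuous_intros)
qed

lemma chart_map_inverse:
  assumes g: "g \<in> hom_maps" and gf: "(g \<circ> f, id) \<in> same_rational_map"
    and z: "f (from_chart z) $ 3 \<noteq> 0" "(g \<circ> f) (from_chart z) $ 3 \<noteq> 0"
  shows "chart_map f z \<in> chart_dom g" "chart_map g (chart_map f z) = z"
proof -
  obtain d where d: "\<And>c v. g (c *s v) = c ^ d *s g v" using hom_maps_homogeneous[OF g] by blast
  have "from_chart (chart_map f z) = (1 / f (from_chart z) $ 3) *s f (from_chart z)"
    using z(1) by (simp add: vec_eq_iff forall_3 chart_map_def Let_def)
  then have gz: "g (from_chart (chart_map f z)) = (1 / f (from_chart z) $ 3) ^ d *s (g \<circ> f) (from_chart z)"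
    by (simp add: d)
  obtain c where c: "(g \<circ> f) (from_chart z) = c *s from_chart z"
    using proportional_imp_scale[OF proportional_sym[OF same_rational_mapD[OF gf]]] by (metis id_apply from_chart_nonzero)
  then have "c \<noteq> 0" using z(2) by auto
  define e where "e = (1 / f (from_chart z) $ 3) ^ d * c"
  have "e \<noteq> 0" using \<open>c \<noteq> 0\<close> z(1) by (simp add: e_def)
  moreover have "g (from_chart (chart_map f z)) = e *s from_chart z"
    unfolding gz c e_def by simp
  ultimately show "chart_map f z \<in> chart_dom g" "chart_map g (chart_map f z) = z"
    unfolding chart_dom_def chart_map_def[of g] by (simp_all add: Let_def)
qed

text \<open>On the open set \<open>U\<close> the chart map of \<open>g\<close> undoes that of
  \<open>f\<close>, so the chain rule gives \<open>D\<close> a left inverse. This supplies the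
  bijectivity under which preservation is tested.\<close>

lemma bij_derivative_of_birational:
  assumes g: "g \<in> hom_maps" and gf: "(g \<circ> f, id) \<in> same_rational_map" and f: "f \<in> hom_maps"
    and z: "f (from_chart z) $ 3 \<noteq> 0" "(g \<circ> f) (from_chart z) $ 3 \<noteq> 0"
    and D: "(chart_map f has_derivative D) (at z)"
  shows "bij D"
proof -
  obtain P Q R where f': "expressed_in_chart f P Q R" using expressed_in_chartE[OF f] .
  have "g \<circ> f \<in> hom_maps" using same_rational_map_hom[OF gf] by blast
  then obtain P1 Q1 R1 where gf': "expressed_in_chart (g \<circ> f) P1 Q1 R1" using expressed_in_chartE by metis
  obtain P2 Q2 R2 where g': "expressed_in_chart g P2 Q2 R2" using expressed_in_chartE[OF g] .
  define U where "U = {z. eval2 (R * R1) (fst z) (snd z) \<noteq> 0}"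
  have U: "z \<in> U \<longleftrightarrow> f (from_chart z) $ 3 \<noteq> 0 \<and> (g \<circ> f) (from_chart z) $ 3 \<noteq> 0" for z
    using f' gf' by (cases z) (simp add: U_def expressed_in_chart_def)
  have "open U" unfolding U_def by (rule open_eval2_nonzero)
  obtain D' where D': "(chart_map g has_derivative D') (at (chart_map f z))"
    using chart_map_has_derivative[OF g' chart_map_inverse(1)[OF g gf z]] by blast
  have "((chart_map g \<circ> chart_map f) has_derivative (D' \<circ> D)) (at z)"
    using diff_chain_at[OF D D'] .
  then have "(id has_derivative (D' \<circ> D)) (at z)"
  proof (rule has_derivative_transform_within_open[OF _ \<open>open U\<close>])
    show "z \<in> U" using z U by blast
    fix w assume "w \<in> U"
    then show "(chart_map g \<circ> chart_map f) w = id w"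
      using chart_map_inverse(2)[OF g gf] U by simp
  qed
  then have "D' \<circ> D = id"
    using has_derivative_unique has_derivative_id by (metis eq_id_iff)
  then have "inj D" by (metis inj_on_id inj_on_imageI2)
  moreover have "linear D" using D has_derivative_linear by blast
  ultimately show ?thesis
    using linear_injective_imp_surjective by (blast intro: bijI)
qed

lemma dominant_component:
  assumes "dominant f"
  shows "nonzero_form (\<lambda>v. f v $ k)"
  using assms nonzero_form_coordinate[of k] unfolding dominant_def
  by (auto dest: spec[of _ "\<lambda>v. v $ k"])

text \<open>Off the zeros of \<open>?q\<close> the preservation hypothesis applies and elimination
  of the scalar \<open>c\<close> makes the defect vanish. The product of the defect with the
  polynomial of \<open>?q\<close> is then identically zero, and the second factor is not.\<close>

lemma defect_of_preserving_birational:
  assumes \<tau>: "\<tau> \<noteq> 0" and bir: "birational f"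
    and pres: "preserves_foliation (rational_map_of f) (L_foliation \<tau>)"
    and f': "expressed_in_chart f P Q R"
  shows "foliation_defect \<tau> P Q R = 0"
proof -
  obtain g where g: "g \<in> hom_maps" "(g \<circ> f, id) \<in> same_rational_map" and f: "f \<in> hom_maps"
    using bir by (auto simp: birational_def)
  have "g \<circ> f \<in> hom_maps" using same_rational_map_hom[OF g(2)] by blast
  obtain l where "nonzero_form (\<lambda>v. (g \<circ> f) v $ l)" using hom_maps_component[OF \<open>g \<circ> f \<in> hom_maps\<close>] .
  have f_nz: "nonzero_form (\<lambda>v. f v $ k)" for k
    using dominant_component[OF birational_dominant[OF bir]] .
  have gf_nz: "nonzero_form (\<lambda>v. (g \<circ> f) v $ 3)"
  proof -
    obtain v where v: "(g \<circ> f) v $ l * v $ 3 \<noteq> 0"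
      using nonzero_form_mult[OF \<open>nonzero_form (\<lambda>v. (g \<circ> f) v $ l)\<close> nonzero_form_coordinate[of 3]]
      by (auto simp: nonzero_form_def)
    then have "(g \<circ> f) v \<noteq> 0" by auto
    \<comment> \<open>The value at \<open>v\<close> is nonzero and proportional to \<open>v\<close>,
      which lies off the line at infinity.\<close>
    have "(g \<circ> f) v $ 3 * v $ l = (g \<circ> f) v $ l * v $ 3"
      using same_rational_mapD[OF g(2), of v] by (simp add: proportional_def)
    then have "(g \<circ> f) v $ 3 \<noteq> 0" using v by auto
    moreover obtain d where "\<And>k. form d (\<lambda>v. (g \<circ> f) v $ k)" using hom_maps_forms[OF \<open>g \<circ> f \<in> hom_maps\<close>] by blast
    ultimately show ?thesis unfolding nonzero_form_def by blast
  qed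
  \<comment> \<open>The third components of \<open>f\<close> and \<open>g \<circ> f\<close> put the
    point under the inverse chart map and so make the differential bijective; the first coordinates
    of the point and of its image keep both away from the singular origin.\<close>
  let ?q = "\<lambda>v. (f v $ 1 * f v $ 3) * ((g \<circ> f) v $ 3 * v $ 1)"
  have q: "nonzero_form ?q"
    by (intro nonzero_form_mult f_nz gf_nz nonzero_form_coordinate)
  have defect: "eval2 (foliation_defect \<tau> P Q R) (fst z) (snd z) = 0" if "?q (from_chart z) \<noteq> 0" for z
  proof -
    have z: "z \<in> chart_dom f" "f (from_chart z) $ 3 \<noteq> 0" "(g \<circ> f) (from_chart z) $ 3 \<noteq> 0"
      "f (from_chart z) $ 1 \<noteq> 0" "fst z \<noteq> 0"
      using that by (auto simp: chart_dom_def)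
    obtain D where D: "(chart_map f has_derivative D) (at z)"
      using chart_map_has_derivative[OF f' z(1)] by blast
    have "bij D" using bij_derivative_of_birational[OF g f z(2,3) D] .
    moreover have "fst (chart_map f z) \<noteq> 0" using z by (simp add: chart_map_def Let_def)
    then have "chart_map f z \<in> regular_points (L_foliation \<tau>)" "z \<in> regular_points (L_foliation \<tau>)"
      using z(5) by (auto simp: regular_points_L[OF \<tau>])
    ultimately have "D ` L_foliation \<tau> z = L_foliation \<tau> (chart_map f z)"
      using pres z(1) D rational_map_of_self[OF f] unfolding preserves_foliation_def by blast
    moreover have "(1 * (\<tau> * fst z), 1 * snd z) \<in> L_foliation \<tau> z"
      unfolding L_foliation_eq by blast
    ultimately have "D (1 * (\<tau> * fst z), 1 * snd z) \<in> L_foliation \<tau> (chart_map f z)" by blast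
    then obtain c where
      c: "D (1 * (\<tau> * fst z), 1 * snd z) = (c * (\<tau> * fst (chart_map f z)), c * snd (chart_map f z))"
      unfolding L_foliation_eq by blast
    let ?P = "eval2 P (fst z) (snd z)" and ?Q = "eval2 Q (fst z) (snd z)" and ?R = "eval2 R (fst z) (snd z)"
    let ?DP = "eval2 (euler_deriv \<tau> P) (fst z) (snd z)" and ?DQ = "eval2 (euler_deriv \<tau> Q) (fst z) (snd z)"
      and ?DR = "eval2 (euler_deriv \<tau> R) (fst z) (snd z)"
    have R: "?R \<noteq> 0" using z(1) mem_chart_dom_iff[OF f'] by simp
    have clear: "X = Y * ?R" if "X / ?R\<^sup>2 = Y / ?R" for X Y
      using that R by (simp add: divide_eq_eq power2_eq_square)
    have "?DP * ?R - ?P * ?DR = c * \<tau> * ?P * ?R" "?DQ * ?R - ?Q * ?DR = c * ?Q * ?R"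
      using c unfolding chart_map_derivative_euler[OF f' z(1) D] chart_map_eq[OF f']
      by (auto dest!: clear simp: mult.assoc)
    moreover have "eval2 (foliation_defect \<tau> P Q R) (fst z) (snd z)
        = (?DP * ?R - ?P * ?DR) * ?Q - \<tau> * ?P * (?DQ * ?R - ?Q * ?DR)"
      unfolding foliation_defect_def by (simp add: algebra_simps)
    ultimately show ?thesis by (simp add: algebra_simps)
  qed
  obtain d where d: "form d ?q" using q by (auto simp: nonzero_form_def)
  obtain q' where q': "\<And>x y. ?q (from_chart (x, y)) = eval2 q' x y"
    using form_in_chart[OF d] by blast
  have "q' * foliation_defect \<tau> P Q R = 0"
  proof (rule eval2_eqI)
    fix x y
    show "eval2 (q' * foliation_defect \<tau> P Q R) x y = eval2 0 x y"
    proof (cases "eval2 q' x y = 0")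
      case False
      then have "eval2 (foliation_defect \<tau> P Q R) x y = 0"
        using defect[of "(x, y)"] unfolding q' fst_conv snd_conv by blast
      then show ?thesis by simp
    qed simp
  qed
  moreover have "q' \<noteq> 0"
    using nonzero_form_chart[OF q] q' by (metis eval2_simps(1) surj_pair)
  ultimately show ?thesis by simp
qed

text \<open>A kernel element \<open>k\<close> gives \<open>z\<close> and \<open>k z\<close> the same
  image in the chart. For generic \<open>z\<close> the inverse is nonzero there, hence for both
  points, and it recovers each of them from the same vector \<open>w\<close>.\<close>

lemma birational_imp_trivial_kernel:
  assumes bir: "birational (monomial_form A s)" and "s \<in> torus" "k \<in> torus" "torus_map A (1, 1) k = (1, 1)"
  shows "k = (1, 1)"
proof -
  let ?m = "monomial_form A s"
  obtain g where g: "g \<in> hom_maps" "(g \<circ> ?m, id) \<in> same_rational_map"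
    using bir by (auto simp: birational_def)
  obtain l where l: "nonzero_form (\<lambda>v. (g \<circ> ?m) v $ l)"
    using hom_maps_component same_rational_map_hom[OF g(2)] by blast
  obtain z where z: "(g \<circ> ?m) (from_chart z) $ l * (from_chart z $ 1 * from_chart z $ 2) \<noteq> 0"
    using nonzero_form_chart[OF nonzero_form_mult[OF l torus_generic(1)]] by blast
  then have zt: "z \<in> torus" by (simp add: mem_torus_iff)
  define z' where "z' = (fst k * fst z, snd k * snd z)"
  have zt': "z' \<in> torus" using zt assms(3) by (simp add: z'_def mem_torus_iff)
  have "torus_map A s z' = torus_map A (torus_map A s k) z"
    using torus_map_compose[OF assms(3) zt, of A s "mat 1"] by (simp add: z'_def)
  also have "torus_map A s k = s"
    using assms(4) by (simp add: torus_map_def prod_eq_iff)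
  finally have T: "torus_map A s z' = torus_map A s z" .
  obtain d where d: "\<And>c v. g (c *s v) = c ^ d *s g v" using hom_maps_homogeneous[OF g(1)] by blast
  define w where "w = g (from_chart (torus_map A s z))"
  obtain c where c: "?m (from_chart z) = c *s from_chart (torus_map A s z)" "c \<noteq> 0"
    using monomial_form_in_chart[OF zt] by metis
  obtain c' where c': "?m (from_chart z') = c' *s from_chart (torus_map A s z)" "c' \<noteq> 0"
    using monomial_form_in_chart[OF zt'] T by metis
  have wz: "(g \<circ> ?m) (from_chart z) = c ^ d *s w" "(g \<circ> ?m) (from_chart z') = c' ^ d *s w"
    by (simp_all add: c(1) c'(1) d w_def)
  then have "w \<noteq> 0" using z by auto
  then have nz: "c ^ d *s w \<noteq> 0" "c' ^ d *s w \<noteq> 0" using c(2) c'(2) by simp_all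
  have "proportional (c ^ d *s w) (from_chart z)" "proportional (c' ^ d *s w) (from_chart z')"
    using same_rational_mapD[OF g(2), of "from_chart z"] same_rational_mapD[OF g(2), of "from_chart z'"]
    by (simp_all only: wz id_apply)
  then have "proportional w (from_chart z)" "proportional w (from_chart z')"
    using nz proportional_trans proportional_scale(2) by blast+
  then have "proportional (from_chart z) (from_chart z')"
    using proportional_trans proportional_sym \<open>w \<noteq> 0\<close> by blast
  then have "z = z'" by (simp add: proportional_from_chart_iff)
  then have "fst z' = fst z" "snd z' = snd z" by simp_all
  then have "fst k = 1" "snd k = 1" using zt unfolding z'_def mem_torus_iff by simp_all
  then show ?thesis by (simp add: prod_eq_iff)
qed

text \<open>On points whose coordinates are n-th roots of unity, n being the determinant, the kernel
  condition becomes a pair of linear congruences modulo n. The columns of the adjugate solve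
  them.\<close>

lemma trivial_kernel_imp_det_1:
  assumes \<tau>: "Im \<tau> > 0"
    and eig: "of_int (A $ 1 $ 1) * \<tau> + of_int (A $ 1 $ 2) = \<tau> * (of_int (A $ 2 $ 1) * \<tau> + of_int (A $ 2 $ 2))"
    and ker: "\<And>k. k \<in> torus \<Longrightarrow> torus_map A (1, 1) k = (1, 1) \<Longrightarrow> k = (1, 1)"
  shows "det A = 1"
proof -
  define a b c d where abcd: "a = A $ 1 $ 1" "b = A $ 1 $ 2" "c = A $ 2 $ 1" "d = A $ 2 $ 2"
  define n where "n = a * d - b * c"
  have det: "det A = n" by (simp add: det_2 n_def abcd)
  define \<mu> where "\<mu> = of_int c * \<tau> + of_int d"
  have \<mu>: "of_int a * \<tau> + of_int b = \<tau> * \<mu>" using eig by (simp add: \<mu>_def abcd)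
  have "\<mu> \<noteq> 0"
  proof
    assume "\<mu> = 0"
    have zero: "p = 0 \<and> q = 0" if "of_int p * \<tau> + of_int q = 0" for p q :: int
    proof -
      have "Im (of_int p * \<tau> + of_int q) = 0" using that by simp
      then have "p = 0" using \<tau> by simp
      then show ?thesis using that by simp
    qed
    have "a = 0 \<and> b = 0" "c = 0 \<and> d = 0"
      using zero[of a b] zero[of c d] \<mu> \<open>\<mu> = 0\<close> by (simp_all add: \<mu>_def)
    \<comment> \<open>The matrix is zero and collapses the whole torus; any point other than (1, 1)
      contradicts \<open>ker\<close>.\<close>
    then have "torus_map A (1, 1) (2, 1) = (1, 1)" by (simp add: torus_map_def flip: abcd)
    then show False using ker[of "(2, 1)"] by (simp add: mem_torus_iff)
  qed
  \<comment> \<open>Multiplied by the conjugate of \<mu>, the eigenvector equation has imaginary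
    part n Im \<tau> on the left and |\<mu>|^2 Im \<tau> on the right.\<close>
  have "Im ((of_int a * \<tau> + of_int b) * cnj \<mu>) = Im (\<tau> * (\<mu> * cnj \<mu>))"
    by (simp add: \<mu> mult.assoc)
  also have "\<dots> = Im \<tau> * (norm \<mu>)\<^sup>2"
    unfolding complex_norm_square[symmetric] times_complex.simps Re_complex_of_real Im_complex_of_real
    by (simp only: mult_zero_right add_0_left)
  also have "Im ((of_int a * \<tau> + of_int b) * cnj \<mu>) = of_int n * Im \<tau>"
    by (simp add: \<mu>_def n_def algebra_simps)
  finally have "of_int n = (norm \<mu>)\<^sup>2" using \<tau> by simp
  then have "n > 0" using \<open>\<mu> \<noteq> 0\<close> by (metis of_int_0_less_iff zero_less_norm_iff zero_less_power)
  \<comment> \<open>The powers of a primitive n-th root of unity.\<close>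
  define e where "e = (\<lambda>m. cis (2 * pi * of_int m / of_int n))"
  have e_powi: "e m powi j = e (m * j)" for m j
    by (simp add: e_def cis_power_int algebra_simps)
  have e_mult: "e i * e j = e (i + j)" for i j
    by (simp add: e_def cis_mult ring_distribs add_divide_distrib)
  have e_1: "e m = 1 \<longleftrightarrow> n dvd m" for m
  proof
    assume "e m = 1"
    then have "cos (2 * pi * of_int m / of_int n) = 1"
      by (simp add: e_def complex_eq_iff)
    then obtain j :: int where "2 * pi * of_int m / of_int n = of_int j * 2 * pi"
      by (auto simp: cos_one_2pi_int)
    then have "real_of_int m = of_int (n * j)"
      using \<open>n > 0\<close> by (simp add: field_simps)
    then have "m = n * j" by (simp only: of_int_eq_iff)
    then show "n dvd m" by simp
  next
    assume "n dvd m"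
    then obtain j where "m = n * j" by auto
    then have "2 * pi * of_int m / of_int n = 2 * pi * of_int j" using \<open>n > 0\<close> by simp
    then show "e m = 1" unfolding e_def by (simp only:) (rule cis_multiple_2pi, simp)
  qed
  have e_nz: "e m \<noteq> 0" for m by (simp add: e_def)
  have kernel: "n dvd i \<and> n dvd j" if "n dvd a * i + b * j" "n dvd c * i + d * j" for i j
  proof -
    have one: "torus_map A (1, 1) (e i, e j) = (1, 1)"
      using that by (simp add: torus_map_def e_powi e_mult e_1 mult.commute flip: abcd)
    have "(e i, e j) = (1, 1)" by (rule ker[OF _ one]) (simp add: mem_torus_iff e_nz)
    then show ?thesis by (simp add: e_1)
  qed
  \<comment> \<open>The matrix maps the adjugate columns (d, -c) and (-b, a) to (n, 0) and (0, n).
    Hence n divides every entry, and n^2 divides the determinant n.\<close>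
  have "n dvd d \<and> n dvd - c" by (rule kernel) (simp_all add: n_def algebra_simps)
  moreover have "n dvd - b \<and> n dvd a" by (rule kernel) (simp_all add: n_def algebra_simps)
  ultimately have "n * n dvd a * d - b * c" by (intro dvd_diff mult_dvd_mono) simp_all
  then have "n * n dvd n * 1" by (simp add: n_def)
  then have "n dvd 1" using \<open>n > 0\<close> by (metis dvd_mult_cancel_left less_irrefl)
  then show ?thesis using \<open>n > 0\<close> by (simp add: det)
qed

text \<open>Where the common factor \<open>H\<close> vanishes on the torus, \<open>f\<close> is the
  zero vector and proportional to anything. So \<open>f\<close> passes the test for
  \<open>torus_rational\<close> at every torus point, and its birationality carries over to the
  monomial form.\<close>

lemma preserving_birational_is_monomial:
  assumes \<tau>: "Im \<tau> > 0" and bir: "birational f"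
    and pres: "preserves_foliation (rational_map_of f) (L_foliation \<tau>)"
  obtains A s where "A \<in> I_stab \<tau>" "s \<in> torus" "rational_map_of f = torus_rational A s"
proof -
  have "\<tau> \<noteq> 0" using \<tau> by auto
  have f: "f \<in> hom_maps" using bir by (simp add: birational_def)
  obtain P Q R where f': "expressed_in_chart f P Q R" using expressed_in_chartE[OF f] .
  have e: "f (from_chart z) $ 1 = eval2 P (fst z) (snd z)" "f (from_chart z) $ 2 = eval2 Q (fst z) (snd z)"
    "f (from_chart z) $ 3 = eval2 R (fst z) (snd z)" for z
    using f' by (cases z; simp add: expressed_in_chart_def)+
  have f_nz: "\<exists>z. f (from_chart z) $ k \<noteq> 0" for k
    by (rule nonzero_form_chart[OF dominant_component[OF birational_dominant[OF bir], of k]]) blast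
  have nz: "P \<noteq> 0" "Q \<noteq> 0" "R \<noteq> 0"
    using f_nz[of 1] f_nz[of 2] f_nz[of 3] unfolding e by auto
  have defect: "foliation_defect \<tau> P Q R = 0"
    using defect_of_preserving_birational[OF \<open>\<tau> \<noteq> 0\<close> bir pres f'] .
  obtain H \<alpha> a a' \<beta> b b' \<gamma> c c' where H: "H \<noteq> 0" "\<alpha> \<noteq> 0" "\<beta> \<noteq> 0" "\<gamma> \<noteq> 0"
    and PQR: "P = monom (monom \<alpha> a) a' * H" "Q = monom (monom \<beta> b) b' * H" "R = monom (monom \<gamma> c) c' * H"
    using monomial_multiples_of_defect[OF _ nz defect] \<tau> by (metis less_irrefl)
  \<comment> \<open>Exponents are taken relative to the third component, the denominator of the
    chart map.\<close>
  define A :: "int^2^2" where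
    "A = vector [vector [int a - int c, int a' - int c'], vector [int b - int c, int b' - int c']]"
  define s where "s = (\<alpha> / \<gamma>, \<beta> / \<gamma>)"
  have A: "A $ 1 $ 1 = int a - int c" "A $ 1 $ 2 = int a' - int c'"
    "A $ 2 $ 1 = int b - int c" "A $ 2 $ 2 = int b' - int c'"
    by (simp_all add: A_def)
  have s: "s \<in> torus" using H by (simp add: s_def mem_torus_iff)
  have "proportional (f (from_chart z)) (from_chart (torus_map A s z))" if "z \<in> torus" for z
  proof -
    have powi: "x powi (int i - int j) = x ^ i / x ^ j" if "x \<noteq> 0" for x :: complex and i j
      using that by (simp add: power_int_diff)
    have "f (from_chart z) = (\<gamma> * fst z ^ c * snd z ^ c' * eval2 H (fst z) (snd z)) *s from_chart (torus_map A s z)"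
      using that H
      by (simp add: vec_eq_iff forall_3 e PQR torus_map_def A s_def mem_torus_iff powi poly_monom)
    then show ?thesis by simp
  qed
  then have "f \<in> torus_rational A s"
    using f by (simp add: torus_rational_def rational_map_in_chart_def)
  then have same: "(monomial_form A s, f) \<in> same_rational_map"
    by (simp add: torus_rational_eq mem_rational_map_of_iff)
  have "birational (monomial_form A s)"
    using birational_same[OF bir same_rational_map_sym[OF same]] .
  moreover have eig: "of_int (A $ 1 $ 1) * \<tau> + of_int (A $ 1 $ 2) = \<tau> * (of_int (A $ 2 $ 1) * \<tau> + of_int (A $ 2 $ 2))"
    using defect_monomial_multiples[OF H defect[unfolded PQR]] by (simp add: A)
  ultimately have "det A = 1"
    using trivial_kernel_imp_det_1[OF \<tau>] birational_imp_trivial_kernel s by blast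
  then have "A \<in> I_stab \<tau>" using eig I_stab_iff[OF \<tau>] by blast
  moreover have "rational_map_of f = torus_rational A s"
    unfolding torus_rational_eq
    using rational_map_of_eq_iff same same_rational_map_hom[OF same] by blast
  ultimately show ?thesis using that s by blast
qed

section \<open>The semidirect product\<close>

lemma mat_1_det: "det (mat 1 :: int^2^2) = 1"
  by (simp add: det_2 mat_def)

lemma I_stab_mat_1: "Im \<tau> > 0 \<Longrightarrow> mat 1 \<in> I_stab \<tau>"
  by (simp add: I_stab_iff mat_1_det) (simp add: mat_def)

lemma det_1_of_I_stab: "A \<in> I_stab \<tau> \<Longrightarrow> det A = 1"
  by (simp add: I_stab_def stabilizer_def SL2Z_def)

text \<open>The product keeps (\<tau>, 1) as eigenvector: \<open>B\<close> scales it by \<mu>, and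
  \<open>row\<close> applies one row of \<open>A\<close> to the result.\<close>

lemma I_stab_mult:
  assumes \<tau>: "Im \<tau> > 0" and "A \<in> I_stab \<tau>" "B \<in> I_stab \<tau>"
  shows "A ** B \<in> I_stab \<tau>"
proof -
  define \<mu> where "\<mu> = of_int (B $ 2 $ 1) * \<tau> + of_int (B $ 2 $ 2)"
  have B: "of_int (B $ 1 $ 1) * \<tau> + of_int (B $ 1 $ 2) = \<tau> * \<mu>"
    using assms(3) by (simp add: I_stab_iff[OF \<tau>] \<mu>_def)
  have A: "of_int (A $ 1 $ 1) * \<tau> + of_int (A $ 1 $ 2) = \<tau> * (of_int (A $ 2 $ 1) * \<tau> + of_int (A $ 2 $ 2))"
    using assms(2) by (simp add: I_stab_iff[OF \<tau>])
  have row: "of_int ((A ** B) $ i $ 1) * \<tau> + of_int ((A ** B) $ i $ 2)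
      = (of_int (A $ i $ 1) * \<tau> + of_int (A $ i $ 2)) * \<mu>" for i
  proof -
    have "of_int ((A ** B) $ i $ 1) * \<tau> + of_int ((A ** B) $ i $ 2)
      = of_int (A $ i $ 1) * (of_int (B $ 1 $ 1) * \<tau> + of_int (B $ 1 $ 2)) + of_int (A $ i $ 2) * \<mu>"
      by (simp add: matrix_matrix_mult_def sum_2 \<mu>_def algebra_simps)
    then show ?thesis unfolding B by (simp add: algebra_simps)
  qed
  show ?thesis
    unfolding I_stab_iff[OF \<tau>] row A
    using assms by (simp add: det_mul det_1_of_I_stab)
qed

lemma I_stab_adjugate:
  assumes \<tau>: "Im \<tau> > 0" and A: "A \<in> I_stab \<tau>"
  shows "adjugate A \<in> I_stab \<tau>"
proof -
  have "of_int (A $ 1 $ 1) * \<tau> + of_int (A $ 1 $ 2) = \<tau> * (of_int (A $ 2 $ 1) * \<tau> + of_int (A $ 2 $ 2))"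
    using A by (simp add: I_stab_iff[OF \<tau>])
  then show ?thesis
    using adjugate(3)[OF det_1_of_I_stab[OF A]] by (simp add: I_stab_iff[OF \<tau>] algebra_simps)
qed

lemma linear_ode:
  fixes f :: "complex \<Rightarrow> complex"
  assumes "\<And>t. (f has_field_derivative a * f t) (at t)"
  shows "f t = f 0 * exp (a * t)"
proof -
  have "((\<lambda>t. f t * exp (- (a * t))) has_field_derivative 0) (at t)" for t
    by (rule derivative_eq_intros assms refl)+ (simp add: algebra_simps)
  then obtain c where c: "\<And>t. f t * exp (- (a * t)) = c"
    using has_field_derivative_zero_constant[of UNIV "\<lambda>t. f t * exp (- (a * t))"] by auto
  have "f t = f t * exp (- (a * t)) * exp (a * t)"
    by (simp add: mult.assoc flip: exp_add)
  also have "\<dots> = f 0 * exp (a * t)"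
    using c[of t] c[of 0] by simp
  finally show ?thesis .
qed

text \<open>Uniqueness for the linear equation leaves a single flow, so the set is its one-parameter
  group. Both generating vector fields are instances.\<close>

lemma flow_maps_linear:
  "flow_maps (\<lambda>(x, y). (a * x, b * y)) = {torus_rational (mat 1) (exp (a * t), exp (b * t)) | t. True}"
proof -
  have flow: "is_flow (\<lambda>(x, y). (a * x, b * y)) \<Phi> \<longleftrightarrow> \<Phi> = (\<lambda>t p. (exp (a * t) * fst p, exp (b * t) * snd p))" for \<Phi>
  proof
    assume \<Phi>: "is_flow (\<lambda>(x, y). (a * x, b * y)) \<Phi>"
    have "((\<lambda>s. fst (\<Phi> s p)) has_field_derivative a * fst (\<Phi> t p)) (at t)"
      and "((\<lambda>s. snd (\<Phi> s p)) has_field_derivative b * snd (\<Phi> t p)) (at t)" and "\<Phi> 0 p = p" for t p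
      using \<Phi> unfolding is_flow_def split_def fst_conv snd_conv by blast+
    note flow = linear_ode[OF this(1)] linear_ode[OF this(2)] this(3)
    show "\<Phi> = (\<lambda>t p. (exp (a * t) * fst p, exp (b * t) * snd p))"
    proof (intro ext prod_eqI)
      fix t p
      show "fst (\<Phi> t p) = fst (exp (a * t) * fst p, exp (b * t) * snd p)"
        "snd (\<Phi> t p) = snd (exp (a * t) * fst p, exp (b * t) * snd p)"
        using flow(1)[of t p] flow(2)[of t p] by (simp_all add: flow(3))
    qed
  next
    assume "\<Phi> = (\<lambda>t p. (exp (a * t) * fst p, exp (b * t) * snd p))"
    then show "is_flow (\<lambda>(x, y). (a * x, b * y)) \<Phi>"
      unfolding is_flow_def by (auto intro!: derivative_eq_intros)
  qed
  have "rational_map_in_chart UNIV (\<lambda>p. (exp (a * t) * fst p, exp (b * t) * snd p))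
      = torus_rational (mat 1) (exp (a * t), exp (b * t))" for t
    using torus_rational_linear(1)[of "(exp (a * t), exp (b * t))"] by (simp add: mem_torus_iff)
  then show ?thesis
    unfolding flow_maps_def flow by auto
qed

section \<open>The group law on pairs of a matrix and a torus point\<close>

lemma carrier_Bir_foliation:
  assumes \<tau>: "Im \<tau> > 0"
  shows "carrier (Bir_foliation (L_foliation \<tau>)) = {torus_rational A s | A s. A \<in> I_stab \<tau> \<and> s \<in> torus}"
proof (intro equalityI subsetI)
  fix \<phi> assume "\<phi> \<in> carrier (Bir_foliation (L_foliation \<tau>))"
  then obtain f where "birational f" "\<phi> = rational_map_of f" "preserves_foliation \<phi> (L_foliation \<tau>)"
    by (auto simp: Bir_foliation_def Bir_P2_def)
  then show "\<phi> \<in> {torus_rational A s | A s. A \<in> I_stab \<tau> \<and> s \<in> torus}"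
    using preserving_birational_is_monomial[OF \<tau>] by blast
next
  fix \<phi> assume "\<phi> \<in> {torus_rational A s | A s. A \<in> I_stab \<tau> \<and> s \<in> torus}"
  then show "\<phi> \<in> carrier (Bir_foliation (L_foliation \<tau>))"
    using torus_rational_preserves[OF \<tau>] torus_rational_in_Bir_P2 det_1_of_I_stab
    by (auto simp: Bir_foliation_def)
qed

lemma mult_Bir_foliation:
  assumes "B \<in> I_stab \<tau>" "t \<in> torus"
  shows "torus_rational A s \<otimes>\<^bsub>Bir_foliation F\<^esub> torus_rational B t = torus_rational (A ** B) (torus_map A s t)"
  using torus_rational_mult[OF det_1_of_I_stab[OF assms(1)] assms(2)] by (simp add: Bir_foliation_def)

lemma one_Bir_foliation: "\<one>\<^bsub>Bir_foliation F\<^esub> = torus_rational (mat 1) (1, 1)"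
  by (simp add: Bir_foliation_def Bir_P2_def torus_rational_id)

text \<open>The axioms are checked on the pairs supplied by the classification. Closure under
  composition and inverses is obtained there too, since it is not apparent from a pointwise test of
  preservation.\<close>

lemma group_Bir_foliation:
  assumes \<tau>: "Im \<tau> > 0"
  shows "group (Bir_foliation (L_foliation \<tau>))"
proof (rule groupI)
  let ?G = "Bir_foliation (L_foliation \<tau>)"
  note carrier = carrier_Bir_foliation[OF \<tau>]
  show "\<one>\<^bsub>?G\<^esub> \<in> carrier ?G"
    unfolding carrier one_Bir_foliation using I_stab_mat_1[OF \<tau>] one_in_torus by blast
  fix \<phi> assume "\<phi> \<in> carrier ?G"
  then obtain A s where A: "\<phi> = torus_rational A s" "A \<in> I_stab \<tau>" "s \<in> torus" unfolding carrier by blast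
  show "\<one>\<^bsub>?G\<^esub> \<otimes>\<^bsub>?G\<^esub> \<phi> = \<phi>"
    unfolding one_Bir_foliation A(1) mult_Bir_foliation[OF A(2,3)] by simp
  show "\<exists>\<psi>\<in>carrier ?G. \<psi> \<otimes>\<^bsub>?G\<^esub> \<phi> = \<one>\<^bsub>?G\<^esub>"
  proof -
    obtain t where t: "t \<in> torus" "torus_map (adjugate A) t s = (1, 1)"
      using torus_inverse[OF det_1_of_I_stab[OF A(2)] A(3)] by metis
    have "torus_rational (adjugate A) t \<otimes>\<^bsub>?G\<^esub> \<phi> = \<one>\<^bsub>?G\<^esub>"
      unfolding one_Bir_foliation A(1) mult_Bir_foliation[OF A(2,3)]
      by (simp add: t(2) adjugate[OF det_1_of_I_stab[OF A(2)]])
    then show ?thesis unfolding carrier using I_stab_adjugate[OF \<tau> A(2)] t(1) by blast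
  qed
  fix \<psi> assume "\<psi> \<in> carrier ?G"
  then obtain B t where B: "\<psi> = torus_rational B t" "B \<in> I_stab \<tau>" "t \<in> torus" unfolding carrier by blast
  show "\<phi> \<otimes>\<^bsub>?G\<^esub> \<psi> \<in> carrier ?G"
    unfolding A(1) B(1) mult_Bir_foliation[OF B(2,3)] carrier
    using I_stab_mult[OF \<tau> A(2) B(2)] torus_map_in_torus[OF A(3) B(3)] by blast
  fix \<omega> assume "\<omega> \<in> carrier ?G"
  then obtain C u where C: "\<omega> = torus_rational C u" "C \<in> I_stab \<tau>" "u \<in> torus" unfolding carrier by blast
  show "\<phi> \<otimes>\<^bsub>?G\<^esub> \<psi> \<otimes>\<^bsub>?G\<^esub> \<omega> = \<phi> \<otimes>\<^bsub>?G\<^esub> (\<psi> \<otimes>\<^bsub>?G\<^esub> \<omega>)"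
    unfolding A(1) B(1) C(1) mult_Bir_foliation[OF B(2,3)] mult_Bir_foliation[OF C(2,3)]
      mult_Bir_foliation[OF I_stab_mult[OF \<tau> B(2) C(2)] torus_map_in_torus[OF B(3) C(3)]]
      torus_map_compose[OF B(3) C(3)] matrix_mul_assoc ..
qed

lemma inv_Bir_foliation:
  assumes \<tau>: "Im \<tau> > 0" and A: "A \<in> I_stab \<tau>" "s \<in> torus"
  obtains t where "t \<in> torus" "inv\<^bsub>Bir_foliation (L_foliation \<tau>)\<^esub> (torus_rational A s) = torus_rational (adjugate A) t"
    "torus_map A s t = (1, 1)"
proof -
  let ?G = "Bir_foliation (L_foliation \<tau>)"
  obtain t where t: "t \<in> torus" "torus_map A s t = (1, 1)" "torus_map (adjugate A) t s = (1, 1)"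
    using torus_inverse[OF det_1_of_I_stab[OF A(1)] A(2)] .
  have "torus_rational (adjugate A) t \<otimes>\<^bsub>?G\<^esub> torus_rational A s = \<one>\<^bsub>?G\<^esub>"
    unfolding one_Bir_foliation mult_Bir_foliation[OF A]
    by (simp add: t(3) adjugate[OF det_1_of_I_stab[OF A(1)]])
  then have "inv\<^bsub>?G\<^esub> (torus_rational A s) = torus_rational (adjugate A) t"
    using A t(1) I_stab_adjugate[OF \<tau> A(1)] unfolding carrier_Bir_foliation[OF \<tau>]
    by (intro group.inv_equality[OF group_Bir_foliation[OF \<tau>]])
       (unfold carrier_Bir_foliation[OF \<tau>], blast+)
  then show ?thesis using that t by blast
qed

lemma adjugate_mat_1 [simp]: "adjugate (mat 1) = mat 1"
  by (simp add: vec_eq_iff forall_2 mat_def)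

lemma subgroup_diagonal:
  assumes \<tau>: "Im \<tau> > 0"
  shows "subgroup (torus_rational (mat 1) ` torus) (Bir_foliation (L_foliation \<tau>))"
proof (rule group.subgroupI[OF group_Bir_foliation[OF \<tau>]])
  let ?G = "Bir_foliation (L_foliation \<tau>)"
  note one = I_stab_mat_1[OF \<tau>]
  show "torus_rational (mat 1) ` torus \<subseteq> carrier ?G"
    unfolding carrier_Bir_foliation[OF \<tau>] using one by blast
  show "torus_rational (mat 1) ` torus \<noteq> {}" using one_in_torus by blast
  fix \<phi> assume "\<phi> \<in> torus_rational (mat 1) ` torus"
  then obtain s where s: "\<phi> = torus_rational (mat 1) s" "s \<in> torus" by blast
  show "inv\<^bsub>?G\<^esub> \<phi> \<in> torus_rational (mat 1) ` torus"
    using inv_Bir_foliation[OF \<tau> one s(2)] unfolding s(1) by (metis adjugate_mat_1 image_eqI)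
  fix \<psi> assume "\<psi> \<in> torus_rational (mat 1) ` torus"
  then obtain t where t: "\<psi> = torus_rational (mat 1) t" "t \<in> torus" by blast
  show "\<phi> \<otimes>\<^bsub>?G\<^esub> \<psi> \<in> torus_rational (mat 1) ` torus"
    unfolding s(1) t(1) mult_Bir_foliation[OF one t(2)] matrix_mul_lid
    using torus_map_in_torus[OF s(2) t(2)] by blast
qed

lemma G0_eq:
  assumes \<tau>: "Im \<tau> > 0"
  shows "G0 \<tau> = torus_rational (mat 1) ` torus"
proof -
  let ?G = "Bir_foliation (L_foliation \<tau>)"
  have X: "X_field \<tau> = (\<lambda>(x, y). (\<tau> * x, 1 * y))" and x: "x_dx = (\<lambda>(x, y). (1 * x, 0 * y))"
    by (simp_all add: X_field_def x_dx_def)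
  have X_flow: "flow_maps (X_field \<tau>) = {torus_rational (mat 1) (exp (\<tau> * t), exp t) | t. True}"
    unfolding X flow_maps_linear by simp
  have x_flow: "flow_maps x_dx = {torus_rational (mat 1) (exp t, 1) | t. True}"
    unfolding x flow_maps_linear by simp
  let ?S = "flow_maps (X_field \<tau>) \<union> flow_maps x_dx"
  have S: "?S \<subseteq> torus_rational (mat 1) ` torus"
    unfolding X_flow x_flow by (auto simp: mem_torus_iff)
  show ?thesis
    unfolding G0_def
  proof (intro equalityI subsetI)
    fix \<phi> assume "\<phi> \<in> generate ?G ?S"
    then show "\<phi> \<in> torus_rational (mat 1) ` torus"
      using group.generate_subgroup_incl[OF group_Bir_foliation[OF \<tau>] S subgroup_diagonal[OF \<tau>]] by blast
  next
    fix \<phi> assume "\<phi> \<in> torus_rational (mat 1) ` torus"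
    then obtain s where s: "\<phi> = torus_rational (mat 1) s" "s \<in> torus" by blast
    \<comment> \<open>Time \<open>t\<close> along X_\<tau> produces the second coordinate of
      \<open>s\<close>; time \<open>u\<close> along the other field, which leaves that coordinate
      alone, corrects the first.\<close>
    define t where "t = Ln (snd s)"
    define u where "u = Ln (fst s) - \<tau> * t"
    have exps: "exp t = snd s" "exp u * exp (\<tau> * t) = fst s"
      using s(2) by (simp_all add: t_def u_def mem_torus_iff flip: exp_add)
    have "(exp (\<tau> * t), exp t) \<in> torus" by (simp add: mem_torus_iff)
    then have "torus_rational (mat 1) (exp u, 1) \<otimes>\<^bsub>?G\<^esub> torus_rational (mat 1) (exp (\<tau> * t), exp t) = \<phi>"
      by (simp add: mult_Bir_foliation[OF I_stab_mat_1[OF \<tau>]] exps s(1))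
    moreover have "torus_rational (mat 1) (exp u, 1) \<in> ?S"
      "torus_rational (mat 1) (exp (\<tau> * t), exp t) \<in> ?S"
      unfolding X_flow x_flow by blast+
    ultimately show "\<phi> \<in> generate ?G ?S"
      using generate.eng generate.incl by metis
  qed
qed

section \<open>The two factors of the product\<close>

lemma monomial_hom:
  assumes \<tau>: "Im \<tau> > 0"
  shows "monomial_map \<in> hom (SL2Z\<lparr>carrier := I_stab \<tau>\<rparr>) (Bir_foliation (L_foliation \<tau>))"
proof (rule homI)
  show "monomial_map A \<in> carrier (Bir_foliation (L_foliation \<tau>))"
    if "A \<in> carrier (SL2Z\<lparr>carrier := I_stab \<tau>\<rparr>)" for A
    using that one_in_torus by (auto simp: carrier_Bir_foliation[OF \<tau>] monomial_map_eq)
  show "monomial_map (A \<otimes>\<^bsub>SL2Z\<lparr>carrier := I_stab \<tau>\<rparr>\<^esub> B)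
      = monomial_map A \<otimes>\<^bsub>Bir_foliation (L_foliation \<tau>)\<^esub> monomial_map B"
    if "A \<in> carrier (SL2Z\<lparr>carrier := I_stab \<tau>\<rparr>)" "B \<in> carrier (SL2Z\<lparr>carrier := I_stab \<tau>\<rparr>)" for A B
    using that(2) mult_Bir_foliation[OF _ one_in_torus, where B = B]
    by (simp add: monomial_map_eq SL2Z_def)
qed

lemma subgroup_monomial:
  assumes \<tau>: "Im \<tau> > 0"
  shows "subgroup (monomial_map ` I_stab \<tau>) (Bir_foliation (L_foliation \<tau>))"
proof (rule group.subgroupI[OF group_Bir_foliation[OF \<tau>]])
  let ?G = "Bir_foliation (L_foliation \<tau>)"
  show "monomial_map ` I_stab \<tau> \<subseteq> carrier ?G"
    using monomial_hom[OF \<tau>] by (auto simp: hom_def)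
  show "monomial_map ` I_stab \<tau> \<noteq> {}" using I_stab_mat_1[OF \<tau>] by blast
  fix \<phi> assume "\<phi> \<in> monomial_map ` I_stab \<tau>"
  then obtain A where A: "\<phi> = monomial_map A" "A \<in> I_stab \<tau>" by blast
  obtain t where t: "inv\<^bsub>?G\<^esub> \<phi> = torus_rational (adjugate A) t" "t \<in> torus" "torus_map A (1, 1) t = (1, 1)"
    using inv_Bir_foliation[OF \<tau> A(2) one_in_torus] unfolding A(1) monomial_map_eq by metis
  \<comment> \<open>The monomial map of \<open>A\<close> is injective on the torus, so the torus
    part of the inverse is trivial and the inverse is again monomial.\<close>
  have "torus_map (adjugate A) (1, 1) (torus_map A (1, 1) t) = t"
    using torus_map_compose[OF one_in_torus t(2), of "adjugate A" "(1, 1)" A]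
    by (simp add: adjugate[OF det_1_of_I_stab[OF A(2)]])
  then have "t = (1, 1)" using t(3) by simp
  then show "inv\<^bsub>?G\<^esub> \<phi> \<in> monomial_map ` I_stab \<tau>"
    using t(1) I_stab_adjugate[OF \<tau> A(2)] by (auto simp: monomial_map_eq)
  fix \<psi> assume "\<psi> \<in> monomial_map ` I_stab \<tau>"
  then obtain B where B: "\<psi> = monomial_map B" "B \<in> I_stab \<tau>" by blast
  have "\<phi> \<otimes>\<^bsub>?G\<^esub> \<psi> = monomial_map (A ** B)"
    unfolding A(1) B(1) monomial_map_eq mult_Bir_foliation[OF B(2) one_in_torus] by simp
  then show "\<phi> \<otimes>\<^bsub>?G\<^esub> \<psi> \<in> monomial_map ` I_stab \<tau>"
    using I_stab_mult[OF \<tau> A(2) B(2)] by blast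
qed

text \<open>Matrix parts multiply, so a conjugate of a map with matrix part \<open>mat 1\<close> has
  matrix part \<open>mat 1\<close> again.\<close>

lemma normal_diagonal:
  assumes \<tau>: "Im \<tau> > 0"
  shows "torus_rational (mat 1) ` torus \<lhd> Bir_foliation (L_foliation \<tau>)"
  unfolding group.normal_inv_iff[OF group_Bir_foliation[OF \<tau>]]
proof (intro conjI subgroup_diagonal[OF \<tau>] ballI)
  let ?G = "Bir_foliation (L_foliation \<tau>)"
  fix \<phi> \<psi> assume "\<phi> \<in> carrier ?G" "\<psi> \<in> torus_rational (mat 1) ` torus"
  then obtain A s t where A: "\<phi> = torus_rational A s" "A \<in> I_stab \<tau>" "s \<in> torus"
    and t: "\<psi> = torus_rational (mat 1) t" "t \<in> torus"
    unfolding carrier_Bir_foliation[OF \<tau>] by blast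
  obtain u where u: "u \<in> torus" "inv\<^bsub>?G\<^esub> \<phi> = torus_rational (adjugate A) u"
    using inv_Bir_foliation[OF \<tau> A(2,3)] A(1) by metis
  have "\<phi> \<otimes>\<^bsub>?G\<^esub> \<psi> \<otimes>\<^bsub>?G\<^esub> inv\<^bsub>?G\<^esub> \<phi> = torus_rational (mat 1) (torus_map A (torus_map A s t) u)"
    unfolding u(2) unfolding A(1) t(1) mult_Bir_foliation[OF I_stab_mat_1[OF \<tau>] t(2)]
      mult_Bir_foliation[OF I_stab_adjugate[OF \<tau> A(2)] u(1)]
    by (simp add: adjugate[OF det_1_of_I_stab[OF A(2)]])
  then show "\<phi> \<otimes>\<^bsub>?G\<^esub> \<psi> \<otimes>\<^bsub>?G\<^esub> inv\<^bsub>?G\<^esub> \<phi> \<in> torus_rational (mat 1) ` torus"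
    using torus_map_in_torus A(3) t(2) u(1) by blast
qed

theorem theorem21:
  fixes \<tau> :: complex
  assumes "Im \<tau> > 0"
  shows "G0 \<tau> \<subseteq> PGL3 \<inter> carrier (Bir_foliation (L_foliation \<tau>))
       \<and> monomial_map \<in> hom (SL2Z\<lparr>carrier := I_stab \<tau>\<rparr>) (Bir_foliation (L_foliation \<tau>))
       \<and> inj_on monomial_map (I_stab \<tau>)
       \<and> internal_semidirect_product (Bir_foliation (L_foliation \<tau>))
           (monomial_map ` I_stab \<tau>) (G0 \<tau>)"
proof (intro conjI)
  let ?G = "Bir_foliation (L_foliation \<tau>)"
  have "G0 \<tau> \<subseteq> carrier ?G"
    unfolding G0_eq[OF assms] using subgroup.subset[OF subgroup_diagonal[OF assms]] .
  then show "G0 \<tau> \<subseteq> PGL3 \<inter> carrier ?G"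
    using torus_rational_linear(2) G0_eq[OF assms] by auto
  show hom: "monomial_map \<in> hom (SL2Z\<lparr>carrier := I_stab \<tau>\<rparr>) ?G"
    by (rule monomial_hom[OF assms])
  show "inj_on monomial_map (I_stab \<tau>)"
    by (rule inj_onI) (simp add: monomial_map_eq torus_rational_inject one_in_torus)
  show "internal_semidirect_product ?G (monomial_map ` I_stab \<tau>) (G0 \<tau>)"
    unfolding internal_semidirect_product_def G0_eq[OF assms]
  proof (intro conjI normal_diagonal[OF assms] subgroup_monomial[OF assms])
    show "monomial_map ` I_stab \<tau> \<inter> torus_rational (mat 1) ` torus = {\<one>\<^bsub>?G\<^esub>}"
    proof (intro equalityI subsetI)
      fix \<phi> assume "\<phi> \<in> monomial_map ` I_stab \<tau> \<inter> torus_rational (mat 1) ` torus"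
      then obtain A s where "\<phi> = torus_rational A (1, 1)" "\<phi> = torus_rational (mat 1) s" "s \<in> torus"
        unfolding monomial_map_eq by blast
      then show "\<phi> \<in> {\<one>\<^bsub>?G\<^esub>}"
        using torus_rational_inject[OF one_in_torus] unfolding one_Bir_foliation by blast
    next
      fix \<phi> assume "\<phi> \<in> {\<one>\<^bsub>?G\<^esub>}"
      then show "\<phi> \<in> monomial_map ` I_stab \<tau> \<inter> torus_rational (mat 1) ` torus"
        unfolding one_Bir_foliation monomial_map_eq using I_stab_mat_1[OF assms] one_in_torus by blast
    qed
    show "monomial_map ` I_stab \<tau> <#>\<^bsub>?G\<^esub> torus_rational (mat 1) ` torus = carrier ?G"
    proof (intro equalityI subsetI)
      fix \<phi> assume "\<phi> \<in> monomial_map ` I_stab \<tau> <#>\<^bsub>?G\<^esub> torus_rational (mat 1) ` torus"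
      then obtain A t where "A \<in> I_stab \<tau>" "t \<in> torus" "\<phi> = monomial_map A \<otimes>\<^bsub>?G\<^esub> torus_rational (mat 1) t"
        unfolding set_mult_def by blast
      moreover from this have "\<phi> = torus_rational A (torus_map A (1, 1) t)"
        using mult_Bir_foliation[OF I_stab_mat_1[OF assms]] by (simp add: monomial_map_eq)
      ultimately show "\<phi> \<in> carrier ?G"
        unfolding carrier_Bir_foliation[OF assms] using torus_map_in_torus[OF one_in_torus] by blast
    next
      fix \<phi> assume "\<phi> \<in> carrier ?G"
      then obtain A s where A: "\<phi> = torus_rational A s" "A \<in> I_stab \<tau>" "s \<in> torus"
        unfolding carrier_Bir_foliation[OF assms] by blast
      \<comment> \<open>With the diagonal factor on the right, the monomial map acts on its torus
        part; \<open>t\<close> is the preimage of \<open>s\<close> under that action.\<close>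
      define t where "t = torus_map (adjugate A) (1, 1) s"
      have t: "t \<in> torus" unfolding t_def by (rule torus_map_in_torus[OF one_in_torus A(3)])
      have s: "torus_map A (1, 1) t = s"
        unfolding t_def using torus_map_compose[OF one_in_torus A(3), of A "(1, 1)" "adjugate A"]
        by (simp add: adjugate[OF det_1_of_I_stab[OF A(2)]])
      have "\<phi> = monomial_map A \<otimes>\<^bsub>?G\<^esub> torus_rational (mat 1) t"
        unfolding monomial_map_eq A(1) mult_Bir_foliation[OF I_stab_mat_1[OF assms] t] s matrix_mul_rid ..
      then show "\<phi> \<in> monomial_map ` I_stab \<tau> <#>\<^bsub>?G\<^esub> torus_rational (mat 1) ` torus"
        unfolding set_mult_def using A(2) t by blast
    qed
  qed
qed

end
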